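(* Let $n$ be a positive integer. There is no bialgebra structure on the $\mathbb Q$-algebra $\mathcal Q_n$ which extends the bialgebra structure on $NSym(n)$ along the embedding $\Phi_n: NSym(n)\hookrightarrow \mathcal Q_n$. That is, there do not exist $\mathbb Q$-linear maps $\tilde\Delta:\mathcal Q_n\to\mathcal Q_n\otimes_{\mathbb Q}\mathcal Q_n$ and $\tilde\varepsilon:\mathcal Q_n\to\mathbb Q$ which make the algebra $\mathcal Q_n$ (with its given multiplication and unit) into a bialgebra over $\mathbb Q$ and satisfy $\tilde\Delta\circ\Phi_n=(\Phi_n\otimes\Phi_n)\circ\Delta$ and $\tilde\varepsilon\circ\Phi_n=\varepsilon$, where $(\Delta,\varepsilon)$ is the coalgebra structure of $NSym(n)$.
   Context: All algebras are associative and unital over $\mathbb Q$; write $[n]=\{1,\ldots,n\}$. A bialgebra is an algebra with a coassociative, counital coalgebra structure whose comultiplication and counit are unital algebra homomorphisms. The algebra $\mathcal Q_n$ (the algebra of pseudo-roots of noncommutative polynomials of degree $n$) is the $\mathbb Q$-algebra with generators $x_{A,i}$, for all subsets $A\subseteq[n]$ with $0\le |A|\le n-1$ and all $i\in[n]\setminus A$, and with relations $$x_{A\cup\{i\},j}+x_{A,i}=x_{A\cup\{j\},i}+x_{A,j},\qquad x_{A\cup\{i\},j}\cdot x_{A,i}=x_{A\cup\{j\},i}\cdot x_{A,j}$$ for all $A\subseteq [n]$ and all $i\neq j$ in $[n]\setminus A$. In $\mathcal Q_n$, for $1\le r\le n$ put $y_r=x_{\{1,2,\ldots,r-1\},r}$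 (so $y_1=x_{\emptyset,1}$), and $$e_r=\sum_{n\ge i_r>\cdots>i_2>i_1\ge 1} y_{i_r}\cdots y_{i_2}y_{i_1}.$$ In particular $e_1=y_n+\cdots+y_1$ and $e_n=y_ny_{n-1}\cdots y_1$. $NSym(n)$ is the free associative $\mathbb Q$-algebra on generators $z_1,\ldots,z_n$, with $z_0=1$. Its bialgebra structure $(\Delta,\varepsilon)$ is given on generators by $\Delta(z_r)=\sum_{i+j=r}z_i\otimes z_j$ (sum over $i,j\ge 0$) and $\varepsilon(z_r)=\delta_{0r}$, extended as algebra homomorphisms. $\Phi_n:NSym(n)\to\mathcal Q_n$ is the (injective) unital algebra homomorphism defined by $\Phi_n(z_r)=e_r$ for $1\le r\le n$.
   Formalization: The formal theorem assumes n ≥ 2 instead of n positive: for n = 1 the claim is false, since Q_1 is free on x_{∅,1} and Φ_1 is an isomorphism, along which the bialgebra structure of NSym(1) transports to Q_1. *)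

theory Defs
  imports Complex_Main "HOL-Algebra.Module" "HOL-Algebra.QuotRing" "HOL-Library.Poly_Mapping"
begin

section \<open>Associative unital algebras over the rationals\<close>

text \<open>The rational numbers, both as the ring of scalars and as an algebra over itself.\<close>

definition rat_alg :: "(rat, rat) module" where
  "rat_alg =
     \<lparr>carrier = UNIV, mult = (*), one = 1, zero = 0, add = (+), smult = (*)\<rparr>"

text \<open>The locale \<open>algebra\<close> of HOL-Algebra requires commutativity, so it cannot be used here.\<close>

locale rat_algebra = module rat_alg A + ring A for A (structure) +
  assumes smult_mult_left:
      "\<lbrakk>x \<in> carrier A; y \<in> carrier A\<rbrakk> \<Longrightarrow> (q \<odot> x) \<otimes> y = q \<odot> (x \<otimes> y)"
    and smult_mult_right:
      "\<lbrakk>x \<in> carrier A; y \<in> carrier A\<rbrakk> \<Longrightarrow> x \<otimes> (q \<odot> y) = q \<odot> (x \<otimes> y)"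

definition algebra_hom :: "(rat, 'a) module \<Rightarrow> (rat, 'b) module \<Rightarrow> ('a \<Rightarrow> 'b) set" where
  "algebra_hom A B =
     {f \<in> ring_hom A B. \<forall>q. \<forall>x\<in>carrier A. f (q \<odot>\<^bsub>A\<^esub> x) = q \<odot>\<^bsub>B\<^esub> f x}"

text \<open>The scalar action on cosets follows the pattern of \<^const>\<open>rcoset_mult\<close>.\<close>

definition quot_alg :: "(rat, 'a) module \<Rightarrow> 'a set \<Rightarrow> (rat, 'a set) module" where
  "quot_alg A I =
     \<lparr>carrier = carrier (A Quot I), mult = mult (A Quot I), one = one (A Quot I),
      zero = zero (A Quot I), add = add (A Quot I),
      smult = (\<lambda>q X. \<Union>x\<in>X. I +>\<^bsub>A\<^esub> (q \<odot>\<^bsub>A\<^esub> x))\<rparr>"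

definition linear_span :: "(rat, 'a) module \<Rightarrow> 'a set \<Rightarrow> 'a set" where
  "linear_span V S = \<Inter>{N. submodule N rat_alg V \<and> S \<subseteq> N}"

text \<open>The algebra of finite formal rational linear combinations of elements of a monoid.\<close>

definition monoid_alg :: "('m, 'z) monoid_scheme \<Rightarrow> (rat, 'm \<Rightarrow>\<^sub>0 rat) module" where
  "monoid_alg M =
     \<lparr>carrier = {p. Poly_Mapping.keys p \<subseteq> carrier M},
      mult = (\<lambda>p q. \<Sum>u\<in>Poly_Mapping.keys p. \<Sum>v\<in>Poly_Mapping.keys q.
        Poly_Mapping.single (u \<otimes>\<^bsub>M\<^esub> v) (Poly_Mapping.lookup p u * Poly_Mapping.lookup q v)),
      one = Poly_Mapping.single \<one>\<^bsub>M\<^esub> 1,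
      zero = 0,
      add = (+),
      smult = (\<lambda>c. Poly_Mapping.map ((*) c))\<rparr>"

definition free_monoid :: "'x set \<Rightarrow> 'x list monoid" where
  "free_monoid X = \<lparr>carrier = lists X, mult = (@), one = []\<rparr>"

definition free_alg :: "'x set \<Rightarrow> (rat, 'x list \<Rightarrow>\<^sub>0 rat) module" where
  "free_alg X = monoid_alg (free_monoid X)"

definition free_gen :: "'x \<Rightarrow> 'x list \<Rightarrow>\<^sub>0 rat" where
  "free_gen x = Poly_Mapping.single [x] 1"

definition list_prod :: "('a, 'z) monoid_scheme \<Rightarrow> 'a list \<Rightarrow> 'a" where
  "list_prod M xs = foldr (mult M) xs \<one>\<^bsub>M\<^esub>"

text \<open>The algebra homomorphism out of a free algebra with prescribed values on the generators.\<close>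

definition free_lift :: "(rat, 'a) module \<Rightarrow> ('x \<Rightarrow> 'a) \<Rightarrow> ('x list \<Rightarrow>\<^sub>0 rat) \<Rightarrow> 'a" where
  "free_lift A f p =
     (\<Oplus>\<^bsub>A\<^esub>w\<in>Poly_Mapping.keys p. Poly_Mapping.lookup p w \<odot>\<^bsub>A\<^esub> list_prod A (map f w))"


section \<open>Tensor products\<close>

text \<open>
  The free vector space on the set of pairs (a, b) carries the product (a, b)(a', b') = (aa', bb').
  The span of the bilinearity relations is stable under multiplication by pairs, hence an ideal,
  so that the quotient is the tensor product of vector spaces with its usual algebra structure.
\<close>

definition tensor_relations ::
  "(rat, 'a) module \<Rightarrow> (rat, 'b) module \<Rightarrow> ('a \<times> 'b \<Rightarrow>\<^sub>0 rat) set" where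
  "tensor_relations A B =
     (let s = (\<lambda>a b. Poly_Mapping.single (a, b)) in
      {s (a \<oplus>\<^bsub>A\<^esub> a') b 1 - (s a b 1 + s a' b 1) | a a' b.
         a \<in> carrier A \<and> a' \<in> carrier A \<and> b \<in> carrier B} \<union>
      {s a (b \<oplus>\<^bsub>B\<^esub> b') 1 - (s a b 1 + s a b' 1) | a b b'.
         a \<in> carrier A \<and> b \<in> carrier B \<and> b' \<in> carrier B} \<union>
      {s (q \<odot>\<^bsub>A\<^esub> a) b 1 - s a b q | q a b. a \<in> carrier A \<and> b \<in> carrier B} \<union>
      {s a (q \<odot>\<^bsub>B\<^esub> b) 1 - s a b q | q a b. a \<in> carrier A \<and> b \<in> carrier B})"

definition tensor_kernel ::
  "(rat, 'a) module \<Rightarrow> (rat, 'b) module \<Rightarrow> ('a \<times> 'b \<Rightarrow>\<^sub>0 rat) set" where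
  "tensor_kernel A B = linear_span (monoid_alg (A \<times>\<times> B)) (tensor_relations A B)"

definition tensor_alg ::
  "(rat, 'a) module \<Rightarrow> (rat, 'b) module \<Rightarrow> (rat, ('a \<times> 'b \<Rightarrow>\<^sub>0 rat) set) module" where
  "tensor_alg A B = quot_alg (monoid_alg (A \<times>\<times> B)) (tensor_kernel A B)"

definition tensor ::
  "(rat, 'a) module \<Rightarrow> (rat, 'b) module \<Rightarrow> 'a \<Rightarrow> 'b \<Rightarrow> ('a \<times> 'b \<Rightarrow>\<^sub>0 rat) set" where
  "tensor A B a b = tensor_kernel A B +>\<^bsub>monoid_alg (A \<times>\<times> B)\<^esub> Poly_Mapping.single (a, b) 1"

text \<open>
  The linear map induced by a map \<open>\<beta>\<close> of two arguments; for bilinear \<open>\<beta>\<close> the value does not depend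
  on the representative c of the coset t.
\<close>

definition tensor_lift ::
  "(rat, 'c) module \<Rightarrow> ('a \<Rightarrow> 'b \<Rightarrow> 'c) \<Rightarrow> ('a \<times> 'b \<Rightarrow>\<^sub>0 rat) set \<Rightarrow> 'c" where
  "tensor_lift V \<beta> t =
     (let c = (SOME c. c \<in> t) in
      \<Oplus>\<^bsub>V\<^esub>p\<in>Poly_Mapping.keys c. Poly_Mapping.lookup c p \<odot>\<^bsub>V\<^esub> \<beta> (fst p) (snd p))"

text \<open>The map \<open>f \<otimes> g\<close> into the tensor product of the codomains A and B.\<close>

definition tensor_map ::
  "(rat, 'c) module \<Rightarrow> (rat, 'd) module \<Rightarrow> ('a \<Rightarrow> 'c) \<Rightarrow> ('b \<Rightarrow> 'd) \<Rightarrow>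
     ('a \<times> 'b \<Rightarrow>\<^sub>0 rat) set \<Rightarrow> ('c \<times> 'd \<Rightarrow>\<^sub>0 rat) set" where
  "tensor_map A B f g = tensor_lift (tensor_alg A B) (\<lambda>a b. tensor A B (f a) (g b))"

text \<open>The canonical map from \<open>(A \<otimes> B) \<otimes> C\<close> to \<open>A \<otimes> (B \<otimes> C)\<close>.\<close>

definition tensor_assoc ::
  "(rat, 'a) module \<Rightarrow> (rat, 'b) module \<Rightarrow> (rat, 'c) module \<Rightarrow>
     (('a \<times> 'b \<Rightarrow>\<^sub>0 rat) set \<times> 'c \<Rightarrow>\<^sub>0 rat) set \<Rightarrow> ('a \<times> ('b \<times> 'c \<Rightarrow>\<^sub>0 rat) set \<Rightarrow>\<^sub>0 rat) set" where
  "tensor_assoc A B C =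
     tensor_lift (tensor_alg A (tensor_alg B C))
       (\<lambda>t c. tensor_lift (tensor_alg A (tensor_alg B C))
          (\<lambda>a b. tensor A (tensor_alg B C) a (tensor B C b c)) t)"


section \<open>Bialgebras\<close>

locale rat_bialgebra = rat_algebra A for A :: "(rat, 'a) module" (structure) +
  fixes \<Delta> :: "'a \<Rightarrow> ('a \<times> 'a \<Rightarrow>\<^sub>0 rat) set"
    and \<epsilon> :: "'a \<Rightarrow> rat"
  assumes comult_hom: "\<Delta> \<in> algebra_hom A (tensor_alg A A)"
    and counit_hom: "\<epsilon> \<in> algebra_hom A rat_alg"
    and coassoc: "x \<in> carrier A \<Longrightarrow>
      tensor_assoc A A A (tensor_map (tensor_alg A A) A \<Delta> (\<lambda>a. a) (\<Delta> x)) =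
      tensor_map A (tensor_alg A A) (\<lambda>a. a) \<Delta> (\<Delta> x)"
    and counit_left: "x \<in> carrier A \<Longrightarrow> tensor_lift A (\<lambda>a b. \<epsilon> a \<odot> b) (\<Delta> x) = x"
    and counit_right: "x \<in> carrier A \<Longrightarrow> tensor_lift A (\<lambda>a b. \<epsilon> b \<odot> a) (\<Delta> x) = x"


section \<open>The algebra of pseudo-roots\<close>

text \<open>The pair (A, i) is the index of the generator \<open>x\<^bsub>A,i\<^esub>\<close>.\<close>

definition pr_index :: "nat \<Rightarrow> (nat set \<times> nat) set" where
  "pr_index n = {(A, i). A \<subseteq> {1..n} \<and> card A \<le> n - 1 \<and> i \<in> {1..n} - A}"

definition pr_relations :: "nat \<Rightarrow> ((nat set \<times> nat) list \<Rightarrow>\<^sub>0 rat) set" where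
  "pr_relations n =
     (let F = free_alg (pr_index n); x = (\<lambda>A i. free_gen (A, i)) in
      {(x (A \<union> {i}) j \<oplus>\<^bsub>F\<^esub> x A i) \<ominus>\<^bsub>F\<^esub> (x (A \<union> {j}) i \<oplus>\<^bsub>F\<^esub> x A j) | A i j.
         A \<subseteq> {1..n} \<and> i \<in> {1..n} - A \<and> j \<in> {1..n} - A \<and> i \<noteq> j} \<union>
      {(x (A \<union> {i}) j \<otimes>\<^bsub>F\<^esub> x A i) \<ominus>\<^bsub>F\<^esub> (x (A \<union> {j}) i \<otimes>\<^bsub>F\<^esub> x A j) | A i j.
         A \<subseteq> {1..n} \<and> i \<in> {1..n} - A \<and> j \<in> {1..n} - A \<and> i \<noteq> j})"

definition pr_ideal :: "nat \<Rightarrow> ((nat set \<times> nat) list \<Rightarrow>\<^sub>0 rat) set" where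
  "pr_ideal n = Idl\<^bsub>free_alg (pr_index n)\<^esub> (pr_relations n)"

definition pr_alg :: "nat \<Rightarrow> (rat, ((nat set \<times> nat) list \<Rightarrow>\<^sub>0 rat) set) module" where
  "pr_alg n = quot_alg (free_alg (pr_index n)) (pr_ideal n)"

definition pr_gen :: "nat \<Rightarrow> nat set \<Rightarrow> nat \<Rightarrow> ((nat set \<times> nat) list \<Rightarrow>\<^sub>0 rat) set" where
  "pr_gen n A i = pr_ideal n +>\<^bsub>free_alg (pr_index n)\<^esub> free_gen (A, i)"

definition pr_y :: "nat \<Rightarrow> nat \<Rightarrow> ((nat set \<times> nat) list \<Rightarrow>\<^sub>0 rat) set" where
  "pr_y n r = pr_gen n {1..<r} r"

text \<open>Index tuples \<open>i\<^sub>r > \<dots> > i\<^sub>1\<close> are encoded by their sets of entries S.\<close>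

definition pr_e :: "nat \<Rightarrow> nat \<Rightarrow> ((nat set \<times> nat) list \<Rightarrow>\<^sub>0 rat) set" where
  "pr_e n r =
     (\<Oplus>\<^bsub>pr_alg n\<^esub>S\<in>{S. S \<subseteq> {1..n} \<and> card S = r}.
        list_prod (pr_alg n) (map (pr_y n) (rev (sorted_list_of_set S))))"


section \<open>Noncommutative symmetric functions\<close>

definition nsym :: "nat \<Rightarrow> (rat, nat list \<Rightarrow>\<^sub>0 rat) module" where
  "nsym n = free_alg {1..n}"

definition nsym_z :: "nat \<Rightarrow> nat list \<Rightarrow>\<^sub>0 rat" where
  "nsym_z r = (if r = 0 then Poly_Mapping.single [] 1 else free_gen r)"

definition nsym_comult ::
  "nat \<Rightarrow> (nat list \<Rightarrow>\<^sub>0 rat) \<Rightarrow> ((nat list \<Rightarrow>\<^sub>0 rat) \<times> (nat list \<Rightarrow>\<^sub>0 rat) \<Rightarrow>\<^sub>0 rat) set" where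
  "nsym_comult n =
     free_lift (tensor_alg (nsym n) (nsym n))
       (\<lambda>r. \<Oplus>\<^bsub>tensor_alg (nsym n) (nsym n)\<^esub>i\<in>{0..r}.
          tensor (nsym n) (nsym n) (nsym_z i) (nsym_z (r - i)))"

definition nsym_counit :: "(nat list \<Rightarrow>\<^sub>0 rat) \<Rightarrow> rat" where
  "nsym_counit = free_lift rat_alg (\<lambda>r. if r = 0 then 1 else 0)"

text \<open>
  For n = 1 there are no relations and \<open>e\<^sub>1 = y\<^sub>1 = x\<^bsub>{},1\<^esub>\<close>, so this is an isomorphism, along
  which the bialgebra structure transports; non-extendability can only hold for \<open>n \<ge> 2\<close>.
\<close>

definition nsym_embedding ::
  "nat \<Rightarrow> (nat list \<Rightarrow>\<^sub>0 rat) \<Rightarrow> ((nat set \<times> nat) list \<Rightarrow>\<^sub>0 rat) set" where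
  "nsym_embedding n = free_lift (pr_alg n) (pr_e n)"

end

theory Submission
  imports Defs
begin

text \<open>
  The obstruction is numerical and comes from rational characters, that is, algebra homomorphisms
  to \<open>\<rat>\<close>. All defining relations of \<open>Q\<^sub>n\<close> hold for the number 1, so there is a character \<open>\<chi>\<close> of
  \<open>Q\<^sub>n\<close> that sends every generator \<open>x\<^bsub>A,i\<^esub>\<close> to 1 (\<open>pr_one_char_hom\<close>). It sends \<open>e\<^sub>r\<close>, a sum over the
  r-subsets of an n-set, to the binomial coefficient (n choose r).

  A bialgebra structure \<open>\<Delta>\<close> on \<open>Q\<^sub>n\<close> turns \<open>\<chi>\<close> into its convolution square
  \<open>\<phi> = (\<chi> \<otimes> \<chi>) \<circ> \<Delta>\<close>, which is again a character. If \<open>\<Delta>\<close> extends the comultiplication of the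
  noncommutative symmetric functions, then by Vandermonde's identity
  \<open>\<phi>(e\<^sub>r) = \<Sum>\<^sub>i (n choose i) (n choose (r - i)) = (2n choose r)\<close> for \<open>1 \<le> r \<le> n\<close>.

  On the other hand, \<open>\<phi>(e\<^sub>r)\<close> is the r-th elementary symmetric polynomial in the n rational numbers
  \<open>c\<^sub>i = \<phi>(y\<^sub>i)\<close> (\<open>character_pr_e\<close>). As \<open>n \<ge> 2\<close>, the cases r = 1 and r = 2 are available; they give
  \<open>\<Sum> c\<^sub>i = 2n\<close> and \<open>\<Sum> c\<^sub>i\<^sup>2 = (2n)\<^sup>2 - 2 (2n choose 2) = 2n\<close>. Hence
  \<open>\<Sum> (c\<^sub>i - 2)\<^sup>2 = 2n - 8n + 4n = - 2n < 0\<close>, a contradiction. In other words, the truncation of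
  \<open>(1 + t)\<^bsup>2n\<^esup>\<close> at degree n would have to split into n linear factors over \<open>\<rat>\<close>, but it has too few
  real roots.

  The bulk of the text builds the algebra needed for this: monoid algebras, quotients by ideals and
  tensor products are rational algebras, characters factor through quotients
  (\<open>quot_char_hom\<close>), two characters induce a character of the tensor product
  (\<open>tensor_char_hom\<close>), and this is compatible with the map \<open>h \<otimes> k\<close> (\<open>tensor_char_tensor_map\<close>).
\<close>

section \<open>Rational algebras\<close>

lemma rat_alg_simps [simp]:
  "carrier rat_alg = UNIV" "mult rat_alg = (*)" "one rat_alg = 1"
  "zero rat_alg = 0" "add rat_alg = (+)" "smult rat_alg = (*)"
  by (simp_all add: rat_alg_def)

lemma cring_rat_alg: "cring rat_alg"
proof (rule cringI)
  show "abelian_group rat_alg"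
    by (rule abelian_groupI) (auto simp: algebra_simps intro: exI[of _ "- x" for x])
  show "comm_monoid rat_alg"
    by (rule comm_monoidI) (auto simp: algebra_simps)
qed (auto simp: algebra_simps)

lemma rat_algebraI:
  fixes A :: "(rat, 'a) module" (structure)
  assumes "ring A"
    and "\<And>q x. x \<in> carrier A \<Longrightarrow> q \<odot> x \<in> carrier A"
    and "\<And>p q x. x \<in> carrier A \<Longrightarrow> (p + q) \<odot> x = p \<odot> x \<oplus> q \<odot> x"
    and "\<And>q x y. \<lbrakk>x \<in> carrier A; y \<in> carrier A\<rbrakk> \<Longrightarrow> q \<odot> (x \<oplus> y) = q \<odot> x \<oplus> q \<odot> y"
    and "\<And>p q x. x \<in> carrier A \<Longrightarrow> (p * q) \<odot> x = p \<odot> (q \<odot> x)"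
    and "\<And>x. x \<in> carrier A \<Longrightarrow> 1 \<odot> x = x"
    and "\<And>q x y. \<lbrakk>x \<in> carrier A; y \<in> carrier A\<rbrakk> \<Longrightarrow> (q \<odot> x) \<otimes> y = q \<odot> (x \<otimes> y)"
    and "\<And>q x y. \<lbrakk>x \<in> carrier A; y \<in> carrier A\<rbrakk> \<Longrightarrow> x \<otimes> (q \<odot> y) = q \<odot> (x \<otimes> y)"
  shows "rat_algebra A"
proof (intro rat_algebra.intro rat_algebra_axioms.intro)
  show "module rat_alg A"
    using assms by (intro moduleI cring_rat_alg ring.is_abelian_group) auto
qed (use assms in auto)

lemma algebra_homI:
  fixes A :: "(rat, 'a) module" and B :: "(rat, 'b) module"
  assumes "\<And>x. x \<in> carrier A \<Longrightarrow> f x \<in> carrier B"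
    and "\<And>x y. \<lbrakk>x \<in> carrier A; y \<in> carrier A\<rbrakk> \<Longrightarrow> f (x \<otimes>\<^bsub>A\<^esub> y) = f x \<otimes>\<^bsub>B\<^esub> f y"
    and "\<And>x y. \<lbrakk>x \<in> carrier A; y \<in> carrier A\<rbrakk> \<Longrightarrow> f (x \<oplus>\<^bsub>A\<^esub> y) = f x \<oplus>\<^bsub>B\<^esub> f y"
    and "f \<one>\<^bsub>A\<^esub> = \<one>\<^bsub>B\<^esub>"
    and "\<And>q x. x \<in> carrier A \<Longrightarrow> f (q \<odot>\<^bsub>A\<^esub> x) = q \<odot>\<^bsub>B\<^esub> f x"
  shows "f \<in> algebra_hom A B"
  using assms by (auto simp: algebra_hom_def ring_hom_def)

lemma algebra_homD:
  assumes "f \<in> algebra_hom A B"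
  shows "x \<in> carrier A \<Longrightarrow> f x \<in> carrier B"
    and "\<lbrakk>x \<in> carrier A; y \<in> carrier A\<rbrakk> \<Longrightarrow> f (x \<otimes>\<^bsub>A\<^esub> y) = f x \<otimes>\<^bsub>B\<^esub> f y"
    and "\<lbrakk>x \<in> carrier A; y \<in> carrier A\<rbrakk> \<Longrightarrow> f (x \<oplus>\<^bsub>A\<^esub> y) = f x \<oplus>\<^bsub>B\<^esub> f y"
    and "f \<one>\<^bsub>A\<^esub> = \<one>\<^bsub>B\<^esub>"
    and "x \<in> carrier A \<Longrightarrow> f (q \<odot>\<^bsub>A\<^esub> x) = q \<odot>\<^bsub>B\<^esub> f x"
  using assms by (auto simp: algebra_hom_def ring_hom_def)

lemma algebra_hom_compose:
  assumes "f \<in> algebra_hom A B" "g \<in> algebra_hom B C"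
  shows "(\<lambda>x. g (f x)) \<in> algebra_hom A C"
  by (rule algebra_homI) (simp_all add: algebra_homD[OF assms(1)] algebra_homD[OF assms(2)])

lemma character_zero:
  assumes "abelian_monoid A" "f \<in> algebra_hom A rat_alg"
  shows "f \<zero>\<^bsub>A\<^esub> = 0"
proof -
  interpret abelian_monoid A by fact
  show ?thesis
    using algebra_homD(3)[OF assms(2), of "\<zero>\<^bsub>A\<^esub>" "\<zero>\<^bsub>A\<^esub>"] by simp
qed

lemma character_minus:
  assumes "abelian_group A" "f \<in> algebra_hom A rat_alg" "x \<in> carrier A" "y \<in> carrier A"
  shows "f (x \<ominus>\<^bsub>A\<^esub> y) = f x - f y"
proof -
  interpret abelian_group A by fact
  have "f (\<ominus>\<^bsub>A\<^esub> y) = - f y"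
    using algebra_homD(3)[OF assms(2), of y "\<ominus>\<^bsub>A\<^esub> y"] assms(4)
    by (simp add: r_neg character_zero[OF abelian_monoid_axioms assms(2)])
  then show ?thesis
    using assms(3,4) by (simp add: a_minus_def algebra_homD(3)[OF assms(2)])
qed

lemma character_finsum:
  assumes "abelian_monoid A" "f \<in> algebra_hom A rat_alg" "finite I"
    and "\<And>i. i \<in> I \<Longrightarrow> g i \<in> carrier A"
  shows "f (\<Oplus>\<^bsub>A\<^esub>i\<in>I. g i) = (\<Sum>i\<in>I. f (g i))"
proof -
  interpret abelian_monoid A by fact
  show ?thesis
    using assms(3,4)
  proof (induction I rule: finite_induct)
    case empty
    show ?case by (simp add: character_zero[OF assms(1,2)])
  next
    case (insert i I)
    have "f (\<Oplus>\<^bsub>A\<^esub>i\<in>insert i I. g i) = f (g i \<oplus>\<^bsub>A\<^esub> (\<Oplus>\<^bsub>A\<^esub>i\<in>I. g i))"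
      using insert by (subst finsum_insert) auto
    also have "\<dots> = f (g i) + f (\<Oplus>\<^bsub>A\<^esub>i\<in>I. g i)"
      using insert by (subst algebra_homD(3)[OF assms(2)]) (auto intro!: finsum_closed)
    finally show ?case using insert by simp
  qed
qed

lemma list_prod_closed:
  assumes "Group.monoid M" "set xs \<subseteq> carrier M"
  shows "list_prod M xs \<in> carrier M"
proof -
  interpret Group.monoid M by fact
  show ?thesis using assms(2) by (induction xs) (auto simp: list_prod_def)
qed

lemma character_list_prod:
  assumes "Group.monoid A" "f \<in> algebra_hom A rat_alg" "set xs \<subseteq> carrier A"
  shows "f (list_prod A xs) = prod_list (map f xs)"
  using assms(3)
proof (induction xs)
  case Nil
  show ?case by (simp add: list_prod_def algebra_homD(4)[OF assms(2)])
next
  case (Cons x xs)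
  then have "list_prod A xs \<in> carrier A"
    by (intro list_prod_closed assms(1)) auto
  with Cons show ?case
    by (simp add: list_prod_def algebra_homD(2)[OF assms(2)])
qed


section \<open>Monoid algebras\<close>

text \<open>
  The linear extension of a function on a monoid is used twice over. For a multiplicative function it
  is a character of the monoid algebra. For arbitrary functions the linear extensions separate points
  (\<open>linear_ext_eqI\<close>) and turn products into iterated extensions (\<open>linear_ext_monoid_alg_mult\<close>), so that
  identities in the monoid algebra reduce to identities in the monoid.
\<close>

definition linear_ext :: "('m \<Rightarrow> rat) \<Rightarrow> ('m \<Rightarrow>\<^sub>0 rat) \<Rightarrow> rat" where
  "linear_ext f p = (\<Sum>u\<in>Poly_Mapping.keys p. Poly_Mapping.lookup p u * f u)"

lemma linear_ext_superset:
  assumes "finite S" "Poly_Mapping.keys p \<subseteq> S"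
  shows "linear_ext f p = (\<Sum>u\<in>S. Poly_Mapping.lookup p u * f u)"
  unfolding linear_ext_def using assms
  by (intro sum.mono_neutral_left) (auto simp: in_keys_iff)

lemma linear_ext_zero [simp]: "linear_ext f 0 = 0"
  by (simp add: linear_ext_def)

lemma linear_ext_add [simp]: "linear_ext f (p + q) = linear_ext f p + linear_ext f q"
proof -
  let ?S = "Poly_Mapping.keys p \<union> Poly_Mapping.keys q"
  have "Poly_Mapping.keys (p + q) \<subseteq> ?S" by (rule keys_add)
  then show ?thesis
    by (simp add: linear_ext_superset[of ?S] lookup_add distrib_right sum.distrib)
qed

lemma linear_ext_uminus [simp]: "linear_ext f (- p) = - linear_ext f p"
  using linear_ext_add[of f p "- p"] by simp

lemma linear_ext_diff [simp]: "linear_ext f (p - q) = linear_ext f p - linear_ext f q"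
  using linear_ext_add[of f p "- q"] by simp

lemma linear_ext_sum: "linear_ext f (\<Sum>i\<in>I. p i) = (\<Sum>i\<in>I. linear_ext f (p i))"
  by (induction I rule: infinite_finite_induct) simp_all

lemma linear_ext_single [simp]: "linear_ext f (Poly_Mapping.single u a) = a * f u"
  by (subst linear_ext_superset[of "{u}"]) (auto simp: lookup_single)

lemma lookup_scale [simp]:
  "Poly_Mapping.lookup (Poly_Mapping.map ((*) q) p) u = q * (Poly_Mapping.lookup p u :: rat)"
  by (auto simp: map.rep_eq when_def)

lemma keys_scale: "Poly_Mapping.keys (Poly_Mapping.map ((*) q) p) \<subseteq> Poly_Mapping.keys (p :: _ \<Rightarrow>\<^sub>0 rat)"
  by (auto simp: in_keys_iff)

lemma linear_ext_scale [simp]: "linear_ext f (Poly_Mapping.map ((*) q) p) = q * linear_ext f p"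
  by (subst linear_ext_superset[of "Poly_Mapping.keys p"])
    (auto simp: keys_scale linear_ext_def sum_distrib_left mult.assoc)

lemma linear_ext_cong:
  assumes "\<And>u. u \<in> Poly_Mapping.keys p \<Longrightarrow> f u = g u"
  shows "linear_ext f p = linear_ext g p"
  using assms by (simp add: linear_ext_def)

text \<open>
  The indicator functions already separate points, since they extend to the coefficient functionals.
\<close>

lemma linear_ext_eqI:
  assumes "\<And>f. linear_ext f p = linear_ext f q"
  shows "p = q"
proof (rule poly_mapping_eqI)
  have *: "linear_ext (\<lambda>v. if v = u then 1 else 0) r = Poly_Mapping.lookup r u" for r u
    by (subst linear_ext_superset[of "insert u (Poly_Mapping.keys r)"])
      (auto simp: if_distrib cong: if_cong)
  show "Poly_Mapping.lookup p u = Poly_Mapping.lookup q u" for u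
    using assms[of "\<lambda>v. if v = u then 1 else 0"] by (simp add: *)
qed

lemma monoid_alg_simps:
  "carrier (monoid_alg M) = {p. Poly_Mapping.keys p \<subseteq> carrier M}"
  "one (monoid_alg M) = Poly_Mapping.single \<one>\<^bsub>M\<^esub> 1"
  "zero (monoid_alg M) = 0"
  "add (monoid_alg M) = (+)"
  "smult (monoid_alg M) q = Poly_Mapping.map ((*) q)"
  by (simp_all add: monoid_alg_def)

lemma linear_ext_monoid_alg_mult:
  "linear_ext f (p \<otimes>\<^bsub>monoid_alg M\<^esub> q) = linear_ext (\<lambda>u. linear_ext (\<lambda>v. f (u \<otimes>\<^bsub>M\<^esub> v)) q) p"
  by (simp add: monoid_alg_def linear_ext_sum)
    (simp add: linear_ext_def sum_distrib_left mult.assoc)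

lemma linear_ext_add_fun: "linear_ext (\<lambda>u. f u + g u) p = linear_ext f p + linear_ext g p"
  by (simp add: linear_ext_def distrib_left sum.distrib)

lemma linear_ext_mult_fun:
  "linear_ext (\<lambda>u. c * f u) p = c * linear_ext f p"
  "linear_ext (\<lambda>u. f u * c) p = linear_ext f p * c"
  by (simp_all add: linear_ext_def sum_distrib_left sum_distrib_right mult_ac)

lemma monoid_alg_mult_single [simp]:
  "Poly_Mapping.single u a \<otimes>\<^bsub>monoid_alg M\<^esub> Poly_Mapping.single v b
     = Poly_Mapping.single (u \<otimes>\<^bsub>M\<^esub> v) (a * b)"
  by (rule linear_ext_eqI) (simp add: linear_ext_monoid_alg_mult mult.assoc)

text \<open>
  After applying an arbitrary linear extension, both sides of the associative law become iterated
  extensions in three arguments, and they agree by associativity in the monoid.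
\<close>

lemma rat_algebra_monoid_alg:
  assumes "Group.monoid M"
  shows "rat_algebra (monoid_alg M)"
proof (rule rat_algebraI)
  interpret Group.monoid M by fact
  let ?R = "monoid_alg M"
  have mult_closed: "p \<otimes>\<^bsub>?R\<^esub> q \<in> carrier ?R" if "p \<in> carrier ?R" "q \<in> carrier ?R" for p q
  proof -
    have "Poly_Mapping.keys (p \<otimes>\<^bsub>?R\<^esub> q) \<subseteq> carrier M"
      unfolding monoid_alg_def using that
      by (auto simp: monoid_alg_simps dest!: subsetD[OF keys_sum] split: if_splits intro!: m_closed)
    then show ?thesis by (simp add: monoid_alg_simps)
  qed
  show "ring ?R"
  proof (rule ringI)
    show "abelian_group ?R"
    proof (rule abelian_groupI)
      fix p assume "p \<in> carrier ?R"
      then show "\<exists>q\<in>carrier ?R. q \<oplus>\<^bsub>?R\<^esub> p = \<zero>\<^bsub>?R\<^esub>"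
        by (intro bexI[of _ "- p"]) (auto simp: monoid_alg_simps in_keys_iff)
    qed (use keys_add in \<open>fastforce simp: monoid_alg_simps add_ac\<close>)+
    show "Group.monoid ?R"
    proof (rule monoidI)
      fix p q r assume "p \<in> carrier ?R" "q \<in> carrier ?R" "r \<in> carrier ?R"
      then show "p \<otimes>\<^bsub>?R\<^esub> q \<otimes>\<^bsub>?R\<^esub> r = p \<otimes>\<^bsub>?R\<^esub> (q \<otimes>\<^bsub>?R\<^esub> r)"
        by (intro linear_ext_eqI)
          (auto simp: linear_ext_monoid_alg_mult monoid_alg_simps subset_iff m_assoc
            intro!: linear_ext_cong)
    next
      fix p assume "p \<in> carrier ?R"
      then show "\<one>\<^bsub>?R\<^esub> \<otimes>\<^bsub>?R\<^esub> p = p" "p \<otimes>\<^bsub>?R\<^esub> \<one>\<^bsub>?R\<^esub> = p"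
        by (auto simp: linear_ext_monoid_alg_mult monoid_alg_simps subset_iff
            intro!: linear_ext_eqI linear_ext_cong)
    qed (use mult_closed in \<open>auto simp: monoid_alg_simps(1,2)\<close>)
  qed (auto intro!: linear_ext_eqI
      simp: linear_ext_monoid_alg_mult linear_ext_add_fun monoid_alg_simps(4))
  show "q \<odot>\<^bsub>?R\<^esub> p \<in> carrier ?R" if "p \<in> carrier ?R" for q p
    using that keys_scale by (fastforce simp: monoid_alg_simps)
qed (auto intro!: linear_ext_eqI simp: linear_ext_monoid_alg_mult linear_ext_mult_fun
    monoid_alg_simps(4,5) algebra_simps)

lemma linear_ext_character:
  assumes "f \<one>\<^bsub>M\<^esub> = 1"
    and "\<And>u v. \<lbrakk>u \<in> carrier M; v \<in> carrier M\<rbrakk> \<Longrightarrow> f (u \<otimes>\<^bsub>M\<^esub> v) = f u * f v"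
  shows "linear_ext f \<in> algebra_hom (monoid_alg M) rat_alg"
proof (rule algebra_homI)
  fix p q assume pq: "p \<in> carrier (monoid_alg M)" "q \<in> carrier (monoid_alg M)"
  have "linear_ext f (p \<otimes>\<^bsub>monoid_alg M\<^esub> q) = linear_ext (\<lambda>u. linear_ext (\<lambda>v. f u * f v) q) p"
    unfolding linear_ext_monoid_alg_mult using pq
    by (intro linear_ext_cong) (auto simp: monoid_alg_simps subset_iff assms(2))
  then show "linear_ext f (p \<otimes>\<^bsub>monoid_alg M\<^esub> q) = linear_ext f p \<otimes>\<^bsub>rat_alg\<^esub> linear_ext f q"
    by (simp add: linear_ext_mult_fun)
qed (simp_all add: monoid_alg_simps assms(1))

text \<open>
  The monoid spans its algebra. This is used to pass from products with monoid elements to arbitrary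
  products.
\<close>

lemma monoid_alg_subset_submodule:
  assumes "submodule N rat_alg (monoid_alg M)"
    and "\<And>u. u \<in> carrier M \<Longrightarrow> Poly_Mapping.single u 1 \<in> N"
  shows "carrier (monoid_alg M) \<subseteq> N"
proof
  interpret submodule N rat_alg "monoid_alg M" by fact
  fix p assume p: "p \<in> carrier (monoid_alg M)"
  have "(\<Sum>u\<in>S. Poly_Mapping.single u (Poly_Mapping.lookup p u)) \<in> N"
    if "finite S" "S \<subseteq> Poly_Mapping.keys p" for S
    using that
  proof (induction S rule: finite_induct)
    case empty
    show ?case using one_closed by (simp add: monoid_alg_simps)
  next
    case (insert u S)
    have "Poly_Mapping.map ((*) (Poly_Mapping.lookup p u)) (Poly_Mapping.single u 1) \<in> N"
      using smult_closed[OF _ assms(2)[of u], of "Poly_Mapping.lookup p u"] insert p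
      by (auto simp: monoid_alg_simps)
    with insert show ?case
      using m_closed by (simp add: monoid_alg_simps)
  qed
  moreover have "p = (\<Sum>u\<in>Poly_Mapping.keys p. Poly_Mapping.single u (Poly_Mapping.lookup p u))"
    by (rule linear_ext_eqI) (simp add: linear_ext_sum, simp add: linear_ext_def)
  ultimately show "p \<in> N" by (metis finite_keys order_refl)
qed


section \<open>Quotient algebras\<close>

lemma quot_alg_simps:
  "carrier (quot_alg A I) = a_rcosets\<^bsub>A\<^esub> I"
  "mult (quot_alg A I) = rcoset_mult A I"
  "one (quot_alg A I) = I +>\<^bsub>A\<^esub> \<one>\<^bsub>A\<^esub>"
  "zero (quot_alg A I) = I"
  "add (quot_alg A I) = set_add A"
  by (simp_all add: quot_alg_def FactRing_def)

lemma quot_alg_carrierE: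
  assumes "X \<in> carrier (quot_alg A I)"
  obtains x where "x \<in> carrier A" "X = I +>\<^bsub>A\<^esub> x"
  using assms by (auto simp: quot_alg_simps A_RCOSETS_def' a_r_coset_def')

text \<open>
  The scalar action on cosets is well defined since ideals of a unital algebra are subspaces:
  \<open>q h = (q 1) h\<close>.
\<close>

lemma quot_alg_smult:
  assumes "rat_algebra A" "ideal I A" "x \<in> carrier A"
  shows "q \<odot>\<^bsub>quot_alg A I\<^esub> (I +>\<^bsub>A\<^esub> x) = I +>\<^bsub>A\<^esub> (q \<odot>\<^bsub>A\<^esub> x)"
proof -
  interpret rat_algebra A by fact
  interpret ideal I A by fact
  have same: "I +>\<^bsub>A\<^esub> (q \<odot>\<^bsub>A\<^esub> y) = I +>\<^bsub>A\<^esub> (q \<odot>\<^bsub>A\<^esub> x)" if "y \<in> I +>\<^bsub>A\<^esub> x" for y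
  proof -
    from that obtain h where h: "h \<in> I" "y = h \<oplus>\<^bsub>A\<^esub> x"
      by (auto simp: a_r_coset_def')
    have hA: "h \<in> carrier A" using h a_subset by blast
    have "q \<odot>\<^bsub>A\<^esub> h = (q \<odot>\<^bsub>A\<^esub> \<one>\<^bsub>A\<^esub>) \<otimes>\<^bsub>A\<^esub> h"
      using hA by (simp add: smult_mult_left)
    also have "\<dots> \<in> I" using h by (intro I_l_closed) auto
    finally have "q \<odot>\<^bsub>A\<^esub> y \<in> I +>\<^bsub>A\<^esub> (q \<odot>\<^bsub>A\<^esub> x)"
      using h hA assms(3) by (auto simp: smult_r_distr a_r_coset_def')
    then show ?thesis
      using assms(3) by (metis a_repr_independence' rat_alg_simps(1) UNIV_I smult_closed)
  qed
  have "(\<Union>y\<in>I +>\<^bsub>A\<^esub> x. I +>\<^bsub>A\<^esub> (q \<odot>\<^bsub>A\<^esub> y)) = I +>\<^bsub>A\<^esub> (q \<odot>\<^bsub>A\<^esub> x)"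
    by (rule UN_constant_eq[OF a_rcos_self[OF assms(3)]]) (intro ballI same)
  then show ?thesis
    by (simp add: quot_alg_def)
qed

lemma rat_algebra_quot_alg:
  assumes "rat_algebra A" "ideal I A"
  shows "rat_algebra (quot_alg A I)"
proof -
  interpret rat_algebra A by fact
  interpret ideal I A by fact
  have rcos: "I +>\<^bsub>A\<^esub> x \<in> carrier (quot_alg A I)" if "x \<in> carrier A" for x
    using that by (simp add: quot_alg_simps a_rcosetsI[OF a_subset])
  have zero: "\<zero>\<^bsub>quot_alg A I\<^esub> = I +>\<^bsub>A\<^esub> \<zero>\<^bsub>A\<^esub>"
    by (simp add: quot_alg_simps a_subset)
  note ops = quot_alg_simps(2,3,5) rcoset_mult_add a_rcos_sum quot_alg_smult[OF assms]
  have scalars: "(p + q) \<odot>\<^bsub>A\<^esub> x = p \<odot>\<^bsub>A\<^esub> x \<oplus>\<^bsub>A\<^esub> q \<odot>\<^bsub>A\<^esub> x"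
    "(p * q) \<odot>\<^bsub>A\<^esub> x = p \<odot>\<^bsub>A\<^esub> (q \<odot>\<^bsub>A\<^esub> x)" "1 \<odot>\<^bsub>A\<^esub> x = x" if "x \<in> carrier A" for p q x
    using smult_l_distr[of p q x] smult_assoc1[of p q x] smult_one[of x] that by simp_all
  show ?thesis
  proof (rule rat_algebraI)
    show "ring (quot_alg A I)"
    proof (rule ringI)
      show "abelian_group (quot_alg A I)"
      proof (rule abelian_groupI)
        fix X assume "X \<in> carrier (quot_alg A I)"
        then obtain x where "x \<in> carrier A" "X = I +>\<^bsub>A\<^esub> x" by (rule quot_alg_carrierE)
        then show "\<exists>Y\<in>carrier (quot_alg A I). Y \<oplus>\<^bsub>quot_alg A I\<^esub> X = \<zero>\<^bsub>quot_alg A I\<^esub>"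
          by (intro bexI[of _ "I +>\<^bsub>A\<^esub> (\<ominus>\<^bsub>A\<^esub> x)"] rcos) (simp_all add: ops zero M.l_neg)
      qed (auto elim!: quot_alg_carrierE simp: ops zero rcos M.a_ac)
      show "Group.monoid (quot_alg A I)"
        by (rule monoidI) (auto elim!: quot_alg_carrierE simp: ops rcos m_assoc)
    qed (auto elim!: quot_alg_carrierE simp: ops l_distr r_distr)
  next
    fix p q X Y assume "X \<in> carrier (quot_alg A I)" "Y \<in> carrier (quot_alg A I)"
    then obtain x y where "x \<in> carrier A" "X = I +>\<^bsub>A\<^esub> x" "y \<in> carrier A" "Y = I +>\<^bsub>A\<^esub> y"
      by (metis quot_alg_carrierE)
    then show "q \<odot>\<^bsub>quot_alg A I\<^esub> X \<in> carrier (quot_alg A I)"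
      "(p + q) \<odot>\<^bsub>quot_alg A I\<^esub> X
         = p \<odot>\<^bsub>quot_alg A I\<^esub> X \<oplus>\<^bsub>quot_alg A I\<^esub> q \<odot>\<^bsub>quot_alg A I\<^esub> X"
      "q \<odot>\<^bsub>quot_alg A I\<^esub> (X \<oplus>\<^bsub>quot_alg A I\<^esub> Y)
         = q \<odot>\<^bsub>quot_alg A I\<^esub> X \<oplus>\<^bsub>quot_alg A I\<^esub> q \<odot>\<^bsub>quot_alg A I\<^esub> Y"
      "(p * q) \<odot>\<^bsub>quot_alg A I\<^esub> X = p \<odot>\<^bsub>quot_alg A I\<^esub> (q \<odot>\<^bsub>quot_alg A I\<^esub> X)"
      "1 \<odot>\<^bsub>quot_alg A I\<^esub> X = X"
      "(q \<odot>\<^bsub>quot_alg A I\<^esub> X) \<otimes>\<^bsub>quot_alg A I\<^esub> Y = q \<odot>\<^bsub>quot_alg A I\<^esub> (X \<otimes>\<^bsub>quot_alg A I\<^esub> Y)"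
      "X \<otimes>\<^bsub>quot_alg A I\<^esub> (q \<odot>\<^bsub>quot_alg A I\<^esub> Y) = q \<odot>\<^bsub>quot_alg A I\<^esub> (X \<otimes>\<^bsub>quot_alg A I\<^esub> Y)"
      by (simp_all add: ops rcos smult_r_distr scalars smult_mult_left smult_mult_right)
  qed
qed

text \<open>
  For a function that is constant on X, this is its value there; see \<open>quot_char_eq\<close>.
\<close>

definition quot_char :: "('a \<Rightarrow> rat) \<Rightarrow> 'a set \<Rightarrow> rat" where
  "quot_char f X = the_elem (f ` X)"

lemma quot_char_eq:
  assumes "ideal I A" "f \<in> algebra_hom A rat_alg" "\<And>x. x \<in> I \<Longrightarrow> f x = 0"
    and "x \<in> carrier A" "y \<in> I +>\<^bsub>A\<^esub> x"
  shows "quot_char f (I +>\<^bsub>A\<^esub> x) = f y"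
proof -
  interpret ideal I A by fact
  have "f z = f x" if "z \<in> I +>\<^bsub>A\<^esub> x" for z
    using that assms(3,4) by (auto simp: a_r_coset_def' algebra_homD(3)[OF assms(2)])
  then have "f ` (I +>\<^bsub>A\<^esub> x) = {f y}"
    using assms(5) by auto
  then show ?thesis by (simp add: quot_char_def)
qed

lemma quot_char_coset:
  assumes "ideal I A" "f \<in> algebra_hom A rat_alg" "\<And>x. x \<in> I \<Longrightarrow> f x = 0"
    and "x \<in> carrier A"
  shows "quot_char f (I +>\<^bsub>A\<^esub> x) = f x"
proof -
  interpret ideal I A by fact
  show ?thesis using assms by (intro quot_char_eq a_rcos_self) auto
qed

lemma quot_char_hom:
  assumes "rat_algebra A" "ideal I A" "f \<in> algebra_hom A rat_alg" "\<And>x. x \<in> I \<Longrightarrow> f x = 0"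
  shows "quot_char f \<in> algebra_hom (quot_alg A I) rat_alg"
proof -
  interpret rat_algebra A by fact
  interpret ideal I A by fact
  note quot_val = quot_char_coset[OF assms(2-4)]
  show ?thesis
  proof (rule algebra_homI)
    fix q X Y assume "X \<in> carrier (quot_alg A I)" "Y \<in> carrier (quot_alg A I)"
    then obtain x y where "x \<in> carrier A" "X = I +>\<^bsub>A\<^esub> x" "y \<in> carrier A" "Y = I +>\<^bsub>A\<^esub> y"
      by (metis quot_alg_carrierE)
    then show "quot_char f (X \<otimes>\<^bsub>quot_alg A I\<^esub> Y) = quot_char f X \<otimes>\<^bsub>rat_alg\<^esub> quot_char f Y"
      "quot_char f (X \<oplus>\<^bsub>quot_alg A I\<^esub> Y) = quot_char f X \<oplus>\<^bsub>rat_alg\<^esub> quot_char f Y"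
      "quot_char f (q \<odot>\<^bsub>quot_alg A I\<^esub> X) = q \<odot>\<^bsub>rat_alg\<^esub> quot_char f X"
      by (simp_all add: quot_alg_simps(2,5) rcoset_mult_add a_rcos_sum
          quot_alg_smult[OF assms(1,2)] quot_val algebra_homD(2,3,5)[OF assms(3)])
  qed (simp_all add: quot_alg_simps(3) quot_val algebra_homD(4)[OF assms(3)])
qed

lemma ideal_character_kernel:
  assumes "rat_algebra A" "f \<in> algebra_hom A rat_alg"
  shows "ideal {x \<in> carrier A. f x = 0} A" "submodule {x \<in> carrier A. f x = 0} rat_alg A"
proof -
  interpret rat_algebra A by fact
  note hom = algebra_homD[OF assms(2)]
  have zero: "f \<zero>\<^bsub>A\<^esub> = 0"
    by (intro character_zero[OF _ assms(2)] M.abelian_monoid_axioms)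
  have minus: "f (\<ominus>\<^bsub>A\<^esub> x) = - f x" if "x \<in> carrier A" for x
    using character_minus[OF M.abelian_group_axioms assms(2), of "\<zero>\<^bsub>A\<^esub>" x] that zero
    by (simp add: a_minus_def)
  show sub: "submodule {x \<in> carrier A. f x = 0} rat_alg A"
    by (rule submoduleI) (auto simp: zero minus hom)
  show "ideal {x \<in> carrier A. f x = 0} A"
    by (rule idealI) (use ring_axioms sub in \<open>auto simp: hom submodule_def\<close>)
qed


section \<open>Tensor products of algebras\<close>

lemma linear_span_submodule:
  assumes "rat_algebra V" "S \<subseteq> carrier V"
  shows "submodule (linear_span V S) rat_alg V"
proof -
  interpret rat_algebra V by fact
  have "submodule (carrier V) rat_alg V"
    by (rule submoduleI) auto
  with assms(2) have "linear_span V S \<subseteq> carrier V"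
    by (auto simp: linear_span_def)
  then show ?thesis
    by (rule submoduleI)
      (auto simp: linear_span_def submodule.smult_closed[where R = rat_alg]
        dest: submoduleE(3,5) subgroup.one_closed[OF submodule.axioms(1)])
qed

lemma linear_span_minimal:
  assumes "submodule N rat_alg V" "S \<subseteq> N"
  shows "linear_span V S \<subseteq> N"
  using assms by (auto simp: linear_span_def)

lemma linear_span_superset: "S \<subseteq> linear_span V S"
  by (auto simp: linear_span_def)

text \<open>
  A subspace pulls back to a subspace under left and right multiplication by a fixed element; this
  lets properties of a span be checked on its generators.
\<close>

lemma submodule_translate:
  assumes "rat_algebra A" "submodule N rat_alg A" "a \<in> carrier A"
  shows "submodule {x \<in> carrier A. a \<otimes>\<^bsub>A\<^esub> x \<in> N} rat_alg A"
    and "submodule {x \<in> carrier A. x \<otimes>\<^bsub>A\<^esub> a \<in> N} rat_alg A"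
proof -
  interpret rat_algebra A by fact
  note N = submoduleE[OF assms(2)] subgroup.one_closed[OF submodule.axioms(1)[OF assms(2)]]
  show "submodule {x \<in> carrier A. a \<otimes>\<^bsub>A\<^esub> x \<in> N} rat_alg A"
    by (rule submoduleI) (use assms(3) N in \<open>auto simp: r_distr r_minus smult_mult_right\<close>)
  show "submodule {x \<in> carrier A. x \<otimes>\<^bsub>A\<^esub> a \<in> N} rat_alg A"
    by (rule submoduleI) (use assms(3) N in \<open>auto simp: l_distr l_minus smult_mult_left\<close>)
qed

lemma rat_algebra_monoid: "rat_algebra A \<Longrightarrow> Group.monoid A"
  by (simp add: rat_algebra_def ring_def)

lemma rat_algebra_pairs:
  assumes "rat_algebra A" "rat_algebra B"
  shows "rat_algebra (monoid_alg (A \<times>\<times> B))"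
  using assms by (intro rat_algebra_monoid_alg DirProd_monoid rat_algebra_monoid)

lemma tensor_relations_cases:
  assumes "r \<in> tensor_relations A B"
  obtains
    (addl) a a' b where "a \<in> carrier A" "a' \<in> carrier A" "b \<in> carrier B"
      "r = Poly_Mapping.single (a \<oplus>\<^bsub>A\<^esub> a', b) 1
         - (Poly_Mapping.single (a, b) 1 + Poly_Mapping.single (a', b) 1)"
  | (addr) a b b' where "a \<in> carrier A" "b \<in> carrier B" "b' \<in> carrier B"
      "r = Poly_Mapping.single (a, b \<oplus>\<^bsub>B\<^esub> b') 1
         - (Poly_Mapping.single (a, b) 1 + Poly_Mapping.single (a, b') 1)"
  | (smultl) q a b where "a \<in> carrier A" "b \<in> carrier B"
      "r = Poly_Mapping.single (q \<odot>\<^bsub>A\<^esub> a, b) 1 - Poly_Mapping.single (a, b) q"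
  | (smultr) q a b where "a \<in> carrier A" "b \<in> carrier B"
      "r = Poly_Mapping.single (a, q \<odot>\<^bsub>B\<^esub> b) 1 - Poly_Mapping.single (a, b) q"
  using assms unfolding tensor_relations_def Let_def by blast

lemma tensor_relationsI:
  "\<lbrakk>a \<in> carrier A; a' \<in> carrier A; b \<in> carrier B\<rbrakk> \<Longrightarrow>
     Poly_Mapping.single (a \<oplus>\<^bsub>A\<^esub> a', b) 1
       - (Poly_Mapping.single (a, b) 1 + Poly_Mapping.single (a', b) 1) \<in> tensor_relations A B"
  "\<lbrakk>a \<in> carrier A; b \<in> carrier B; b' \<in> carrier B\<rbrakk> \<Longrightarrow>
     Poly_Mapping.single (a, b \<oplus>\<^bsub>B\<^esub> b') 1
       - (Poly_Mapping.single (a, b) 1 + Poly_Mapping.single (a, b') 1) \<in> tensor_relations A B"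
  "\<lbrakk>a \<in> carrier A; b \<in> carrier B\<rbrakk> \<Longrightarrow>
     Poly_Mapping.single (q \<odot>\<^bsub>A\<^esub> a, b) 1 - Poly_Mapping.single (a, b) q \<in> tensor_relations A B"
  "\<lbrakk>a \<in> carrier A; b \<in> carrier B\<rbrakk> \<Longrightarrow>
     Poly_Mapping.single (a, q \<odot>\<^bsub>B\<^esub> b) 1 - Poly_Mapping.single (a, b) q \<in> tensor_relations A B"
  unfolding tensor_relations_def Let_def by blast+

lemma monoid_alg_closed:
  "\<lbrakk>p \<in> carrier (monoid_alg M); q \<in> carrier (monoid_alg M)\<rbrakk> \<Longrightarrow> p - q \<in> carrier (monoid_alg M)"
  "\<lbrakk>p \<in> carrier (monoid_alg M); q \<in> carrier (monoid_alg M)\<rbrakk> \<Longrightarrow> p + q \<in> carrier (monoid_alg M)"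
  "u \<in> carrier M \<Longrightarrow> Poly_Mapping.single u c \<in> carrier (monoid_alg M)"
  by (auto simp: monoid_alg_simps subset_iff in_keys_iff lookup_minus lookup_add lookup_single
      when_def split: if_splits) (metis add.right_neutral)+

lemma tensor_relations_carrier:
  assumes "rat_algebra A" "rat_algebra B"
  shows "tensor_relations A B \<subseteq> carrier (monoid_alg (A \<times>\<times> B))"
proof
  interpret A: rat_algebra A by fact
  interpret B: rat_algebra B by fact
  fix r assume "r \<in> tensor_relations A B"
  then show "r \<in> carrier (monoid_alg (A \<times>\<times> B))"
    by (cases rule: tensor_relations_cases) (auto intro!: monoid_alg_closed)
qed

lemma monoid_alg_mult_distrib:
  "p \<otimes>\<^bsub>monoid_alg M\<^esub> (q + r) = p \<otimes>\<^bsub>monoid_alg M\<^esub> q + p \<otimes>\<^bsub>monoid_alg M\<^esub> r"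
  "(p + q) \<otimes>\<^bsub>monoid_alg M\<^esub> r = p \<otimes>\<^bsub>monoid_alg M\<^esub> r + q \<otimes>\<^bsub>monoid_alg M\<^esub> r"
  "p \<otimes>\<^bsub>monoid_alg M\<^esub> (q - r) = p \<otimes>\<^bsub>monoid_alg M\<^esub> q - p \<otimes>\<^bsub>monoid_alg M\<^esub> r"
  "(p - q) \<otimes>\<^bsub>monoid_alg M\<^esub> r = p \<otimes>\<^bsub>monoid_alg M\<^esub> r - q \<otimes>\<^bsub>monoid_alg M\<^esub> r"
  by (auto intro!: linear_ext_eqI simp: linear_ext_monoid_alg_mult)
    (simp_all add: linear_ext_def algebra_simps sum.distrib sum_subtractf)

text \<open>
  Multiplying a bilinearity relation by a pair (u, v) gives a bilinearity relation of the same kind,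
  because multiplication by u and by v is linear.
\<close>

lemma tensor_relations_mult_pair:
  assumes "rat_algebra A" "rat_algebra B" "r \<in> tensor_relations A B"
    and "u \<in> carrier A" "v \<in> carrier B"
  shows "Poly_Mapping.single (u, v) 1 \<otimes>\<^bsub>monoid_alg (A \<times>\<times> B)\<^esub> r \<in> tensor_relations A B"
    and "r \<otimes>\<^bsub>monoid_alg (A \<times>\<times> B)\<^esub> Poly_Mapping.single (u, v) 1 \<in> tensor_relations A B"
proof -
  interpret A: rat_algebra A by fact
  interpret B: rat_algebra B by fact
  from assms(3) show "Poly_Mapping.single (u, v) 1 \<otimes>\<^bsub>monoid_alg (A \<times>\<times> B)\<^esub> r \<in> tensor_relations A B"
    by (cases rule: tensor_relations_cases)
      (use assms(4,5) in \<open>simp_all add: monoid_alg_mult_distrib A.r_distr B.r_distr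
        A.smult_mult_right B.smult_mult_right tensor_relationsI\<close>)
  from assms(3) show "r \<otimes>\<^bsub>monoid_alg (A \<times>\<times> B)\<^esub> Poly_Mapping.single (u, v) 1 \<in> tensor_relations A B"
    by (cases rule: tensor_relations_cases)
      (use assms(4,5) in \<open>simp_all add: monoid_alg_mult_distrib A.l_distr B.l_distr
        A.smult_mult_left B.smult_mult_left tensor_relationsI\<close>)
qed

text \<open>
  By \<open>tensor_relations_mult_pair\<close> the span of the relations is stable under multiplication by pairs,
  on either side; as the pairs span the whole algebra, it is an ideal.
\<close>

lemma ideal_tensor_kernel:
  assumes "rat_algebra A" "rat_algebra B"
  shows "ideal (tensor_kernel A B) (monoid_alg (A \<times>\<times> B))"
proof -
  let ?P = "monoid_alg (A \<times>\<times> B)" and ?K = "tensor_kernel A B"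
  interpret P: rat_algebra ?P by (rule rat_algebra_pairs) fact+
  have K: "submodule ?K rat_alg ?P"
    unfolding tensor_kernel_def
    by (intro linear_span_submodule P.rat_algebra_axioms tensor_relations_carrier assms)
  have sub: "?K \<subseteq> carrier ?P"
    using P.submoduleE(1)[OF K] .
  have rel: "tensor_relations A B \<subseteq> ?K"
    unfolding tensor_kernel_def by (rule linear_span_superset)
  have relP: "tensor_relations A B \<subseteq> carrier ?P"
    by (rule tensor_relations_carrier) fact+
  have single: "Poly_Mapping.single u 1 \<in> carrier ?P" if "u \<in> carrier (A \<times>\<times> B)" for u
    using that by (rule monoid_alg_closed(3))
  have K_min: "?K \<subseteq> N" if "submodule N rat_alg ?P" "tensor_relations A B \<subseteq> N" for N
    unfolding tensor_kernel_def using that by (rule linear_span_minimal)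
  have pair: "Poly_Mapping.single u 1 \<otimes>\<^bsub>?P\<^esub> k \<in> ?K" "k \<otimes>\<^bsub>?P\<^esub> Poly_Mapping.single u 1 \<in> ?K"
    if "u \<in> carrier (A \<times>\<times> B)" "k \<in> ?K" for u k
  proof -
    have "?K \<subseteq> {k \<in> carrier ?P. Poly_Mapping.single u 1 \<otimes>\<^bsub>?P\<^esub> k \<in> ?K}"
      by (intro K_min submodule_translate P.rat_algebra_axioms K single that)
        (use that relP rel tensor_relations_mult_pair(1)[OF assms] in auto)
    then show "Poly_Mapping.single u 1 \<otimes>\<^bsub>?P\<^esub> k \<in> ?K" using that by blast
    have "?K \<subseteq> {k \<in> carrier ?P. k \<otimes>\<^bsub>?P\<^esub> Poly_Mapping.single u 1 \<in> ?K}"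
      by (intro K_min submodule_translate P.rat_algebra_axioms K single that)
        (use that relP rel tensor_relations_mult_pair(2)[OF assms] in auto)
    then show "k \<otimes>\<^bsub>?P\<^esub> Poly_Mapping.single u 1 \<in> ?K" using that by blast
  qed
  show ?thesis
  proof (rule idealI)
    show "ring ?P" by (rule P.ring_axioms)
    show "subgroup ?K (add_monoid ?P)" by (rule submodule.axioms(1)[OF K])
  next
    fix k x assume kx: "k \<in> ?K" "x \<in> carrier ?P"
    have "carrier ?P \<subseteq> {x \<in> carrier ?P. x \<otimes>\<^bsub>?P\<^esub> k \<in> ?K}"
      by (intro monoid_alg_subset_submodule submodule_translate P.rat_algebra_axioms K)
        (use kx sub pair single in auto)
    with kx show "x \<otimes>\<^bsub>?P\<^esub> k \<in> ?K" by blast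
    have "carrier ?P \<subseteq> {x \<in> carrier ?P. k \<otimes>\<^bsub>?P\<^esub> x \<in> ?K}"
      by (intro monoid_alg_subset_submodule submodule_translate P.rat_algebra_axioms K)
        (use kx sub pair single in auto)
    with kx show "k \<otimes>\<^bsub>?P\<^esub> x \<in> ?K" by blast
  qed
qed

lemma rat_algebra_tensor_alg:
  assumes "rat_algebra A" "rat_algebra B"
  shows "rat_algebra (tensor_alg A B)"
  unfolding tensor_alg_def
  by (intro rat_algebra_quot_alg rat_algebra_pairs ideal_tensor_kernel assms)

lemma tensor_closed:
  assumes "rat_algebra A" "rat_algebra B" "a \<in> carrier A" "b \<in> carrier B"
  shows "tensor A B a b \<in> carrier (tensor_alg A B)"
proof -
  interpret P: rat_algebra "monoid_alg (A \<times>\<times> B)" by (rule rat_algebra_pairs) fact+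
  interpret ideal "tensor_kernel A B" "monoid_alg (A \<times>\<times> B)" by (rule ideal_tensor_kernel) fact+
  show ?thesis
    unfolding tensor_def tensor_alg_def quot_alg_simps(1)
    by (intro P.a_rcosetsI a_subset monoid_alg_closed(3)) (simp add: assms)
qed

text \<open>
  The functional \<open>f \<otimes> g\<close>, where \<open>\<rat> \<otimes> \<rat>\<close> is identified with \<open>\<rat>\<close> by multiplication.
\<close>

definition tensor_char :: "('a \<Rightarrow> rat) \<Rightarrow> ('b \<Rightarrow> rat) \<Rightarrow> ('a \<times> 'b \<Rightarrow>\<^sub>0 rat) set \<Rightarrow> rat" where
  "tensor_char f g = quot_char (linear_ext (\<lambda>p. f (fst p) * g (snd p)))"

context
  fixes A :: "(rat, 'a) module" and B :: "(rat, 'b) module"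
    and f :: "'a \<Rightarrow> rat" and g :: "'b \<Rightarrow> rat"
  assumes A: "rat_algebra A" and B: "rat_algebra B"
    and f: "f \<in> algebra_hom A rat_alg" and g: "g \<in> algebra_hom B rat_alg"
begin

lemma pair_character:
  "linear_ext (\<lambda>p. f (fst p) * g (snd p)) \<in> algebra_hom (monoid_alg (A \<times>\<times> B)) rat_alg"
  by (rule linear_ext_character)
    (auto simp: algebra_homD(2,4)[OF f] algebra_homD(2,4)[OF g])

text \<open>
  The product of two linear functionals is bilinear, so it respects the bilinearity relations.
\<close>

lemma pair_character_kernel:
  assumes "k \<in> tensor_kernel A B"
  shows "linear_ext (\<lambda>p. f (fst p) * g (snd p)) k = 0"
proof -
  let ?P = "monoid_alg (A \<times>\<times> B)" and ?L = "linear_ext (\<lambda>p. f (fst p) * g (snd p))"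
  have "?L r = 0" if "r \<in> tensor_relations A B" for r
    using that by (cases rule: tensor_relations_cases; hypsubst;
        simp add: algebra_homD(3,5)[OF f] algebra_homD(3,5)[OF g] algebra_simps)
  with tensor_relations_carrier[OF A B]
  have "tensor_kernel A B \<subseteq> {p \<in> carrier ?P. ?L p = 0}"
    unfolding tensor_kernel_def
    by (intro linear_span_minimal ideal_character_kernel rat_algebra_pairs A B pair_character) auto
  with assms show ?thesis by blast
qed

lemma tensor_char_hom: "tensor_char f g \<in> algebra_hom (tensor_alg A B) rat_alg"
  unfolding tensor_char_def tensor_alg_def
  by (intro quot_char_hom rat_algebra_pairs ideal_tensor_kernel A B pair_character
      pair_character_kernel)

text \<open>
  The induced map \<^const>\<open>tensor_lift\<close> evaluates at an arbitrarily chosen representative. Since the value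
  can be computed at every representative, the choice can be ignored in \<open>tensor_char_tensor_map\<close>.
\<close>

lemma tensor_char_representative:
  assumes "t \<in> carrier (tensor_alg A B)" "c \<in> t"
  shows "tensor_char f g t = linear_ext (\<lambda>p. f (fst p) * g (snd p)) c"
    and "c \<in> carrier (monoid_alg (A \<times>\<times> B))"
proof -
  interpret P: rat_algebra "monoid_alg (A \<times>\<times> B)" by (rule rat_algebra_pairs[OF A B])
  interpret ideal "tensor_kernel A B" "monoid_alg (A \<times>\<times> B)" by (rule ideal_tensor_kernel[OF A B])
  obtain x where x: "x \<in> carrier (monoid_alg (A \<times>\<times> B))"
    and t: "t = tensor_kernel A B +>\<^bsub>monoid_alg (A \<times>\<times> B)\<^esub> x"
    using assms(1) unfolding tensor_alg_def by (rule quot_alg_carrierE)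
  show "tensor_char f g t = linear_ext (\<lambda>p. f (fst p) * g (snd p)) c"
    unfolding tensor_char_def t
    by (intro quot_char_eq ideal_tensor_kernel A B pair_character
        pair_character_kernel x) (use assms(2) t in auto)
  show "c \<in> carrier (monoid_alg (A \<times>\<times> B))"
    using a_elemrcos_carrier[OF x] assms(2) t by blast
qed

lemma tensor_carrier_nonempty:
  assumes "t \<in> carrier (tensor_alg A B)"
  shows "t \<noteq> {}"
proof -
  interpret P: rat_algebra "monoid_alg (A \<times>\<times> B)" by (rule rat_algebra_pairs[OF A B])
  interpret ideal "tensor_kernel A B" "monoid_alg (A \<times>\<times> B)" by (rule ideal_tensor_kernel[OF A B])
  obtain x where "x \<in> carrier (monoid_alg (A \<times>\<times> B))"
    and "t = tensor_kernel A B +>\<^bsub>monoid_alg (A \<times>\<times> B)\<^esub> x"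
    using assms unfolding tensor_alg_def by (rule quot_alg_carrierE)
  then show ?thesis using a_rcos_self by blast
qed

lemma tensor_char_tensor:
  assumes "a \<in> carrier A" "b \<in> carrier B"
  shows "tensor_char f g (tensor A B a b) = f a * g b"
proof -
  interpret P: rat_algebra "monoid_alg (A \<times>\<times> B)" by (rule rat_algebra_pairs[OF A B])
  interpret ideal "tensor_kernel A B" "monoid_alg (A \<times>\<times> B)" by (rule ideal_tensor_kernel[OF A B])
  have "Poly_Mapping.single (a, b) 1 \<in> tensor A B a b"
    unfolding tensor_def using assms by (intro a_rcos_self monoid_alg_closed) auto
  from tensor_char_representative(1)[OF tensor_closed[OF A B assms] this] show ?thesis
    by simp
qed

end

text \<open>
  This is the identity \<open>(f \<otimes> g) \<circ> (h \<otimes> k) = (f \<circ> h) \<otimes> (g \<circ> k)\<close>. Assuming that \<open>f \<circ> h\<close> and \<open>g \<circ> k\<close> are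
  characters avoids a discussion of h and k as homomorphisms.
\<close>

lemma tensor_char_tensor_map:
  assumes "rat_algebra A" "rat_algebra B" "rat_algebra C" "rat_algebra D"
    and "f \<in> algebra_hom A rat_alg" "g \<in> algebra_hom B rat_alg"
    and "(\<lambda>c. f (h c)) \<in> algebra_hom C rat_alg" "(\<lambda>d. g (k d)) \<in> algebra_hom D rat_alg"
    and "\<And>c. c \<in> carrier C \<Longrightarrow> h c \<in> carrier A" "\<And>d. d \<in> carrier D \<Longrightarrow> k d \<in> carrier B"
    and "t \<in> carrier (tensor_alg C D)"
  shows "tensor_char f g (tensor_map A B h k t) = tensor_char (\<lambda>c. f (h c)) (\<lambda>d. g (k d)) t"
proof -
  interpret T: rat_algebra "tensor_alg A B" by (rule rat_algebra_tensor_alg) fact+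
  note T_hom = tensor_char_hom[OF assms(1,2,5,6)]
  define c where "c = (SOME c. c \<in> t)"
  have "c \<in> t"
    unfolding c_def using tensor_carrier_nonempty[OF assms(3,4) assms(7,8,11)] by (simp add: some_in_eq)
  note c = tensor_char_representative[OF assms(3,4,7,8,11) this]
  have keys: "h (fst p) \<in> carrier A" "k (snd p) \<in> carrier B" if "p \<in> Poly_Mapping.keys c" for p
    using that c(2) assms(9,10) by (auto simp: monoid_alg_simps)
  have "tensor_char f g (tensor_map A B h k t)
     = (\<Sum>p\<in>Poly_Mapping.keys c. tensor_char f g
          (Poly_Mapping.lookup c p \<odot>\<^bsub>tensor_alg A B\<^esub> tensor A B (h (fst p)) (k (snd p))))"
    unfolding tensor_map_def tensor_lift_def Let_def c_def[symmetric]
    by (intro character_finsum T_hom T.M.abelian_monoid_axioms)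
      (auto intro!: tensor_closed assms(1,2) keys)
  also have "\<dots> = (\<Sum>p\<in>Poly_Mapping.keys c.
       Poly_Mapping.lookup c p * (f (h (fst p)) * g (k (snd p))))"
    by (intro sum.cong refl)
      (simp add: algebra_homD(5)[OF T_hom] tensor_char_tensor[OF assms(1,2,5,6)]
        tensor_closed[OF assms(1,2)] keys)
  also have "\<dots> = tensor_char (\<lambda>c. f (h c)) (\<lambda>d. g (k d)) t"
    by (simp add: c(1) linear_ext_def)
  finally show ?thesis .
qed


section \<open>Free algebras\<close>

lemma monoid_free_monoid: "Group.monoid (free_monoid X)"
  by (rule monoidI) (auto simp: free_monoid_def)

lemma rat_algebra_free_alg: "rat_algebra (free_alg X)"
  unfolding free_alg_def by (intro rat_algebra_monoid_alg monoid_free_monoid)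

lemma free_alg_carrier:
  "carrier (free_alg X) = {p. Poly_Mapping.keys p \<subseteq> lists X}"
  by (simp add: free_alg_def monoid_alg_simps free_monoid_def)

lemma free_gen_closed: "x \<in> X \<Longrightarrow> free_gen x \<in> carrier (free_alg X)"
  by (simp add: free_alg_carrier free_gen_def)

lemma free_lift_terms_closed:
  assumes "rat_algebra A" "\<And>x. x \<in> X \<Longrightarrow> f x \<in> carrier A" "p \<in> carrier (free_alg X)"
    and "w \<in> Poly_Mapping.keys p"
  shows "list_prod A (map f w) \<in> carrier A"
  using assms(2-4) by (intro list_prod_closed rat_algebra_monoid[OF assms(1)])
    (auto simp: free_alg_carrier)

lemma free_lift_closed:
  assumes "rat_algebra A" "\<And>x. x \<in> X \<Longrightarrow> f x \<in> carrier A" "p \<in> carrier (free_alg X)"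
  shows "free_lift A f p \<in> carrier A"
proof -
  interpret rat_algebra A by fact
  show ?thesis
    unfolding free_lift_def using free_lift_terms_closed[OF assms]
    by (intro M.finsum_closed) auto
qed

text \<open>
  A character of the target turns the homomorphism out of a free algebra into a linear extension,
  which reduces computations with \<^const>\<open>free_lift\<close> to computations with rational numbers.
\<close>

lemma character_free_lift:
  assumes "rat_algebra A" "\<And>x. x \<in> X \<Longrightarrow> f x \<in> carrier A" "p \<in> carrier (free_alg X)"
    and "\<chi> \<in> algebra_hom A rat_alg"
  shows "\<chi> (free_lift A f p) = linear_ext (\<lambda>w. \<Prod>x\<leftarrow>w. \<chi> (f x)) p"
proof -
  interpret rat_algebra A by fact
  have "\<chi> (free_lift A f p)
     = (\<Sum>w\<in>Poly_Mapping.keys p. \<chi> (Poly_Mapping.lookup p w \<odot>\<^bsub>A\<^esub> list_prod A (map f w)))"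
    unfolding free_lift_def using free_lift_terms_closed[OF assms(1-3)]
    by (intro character_finsum assms(4) M.abelian_monoid_axioms) auto
  also have "\<dots> = linear_ext (\<lambda>w. \<Prod>x\<leftarrow>w. \<chi> (f x)) p"
    unfolding linear_ext_def
  proof (intro sum.cong refl)
    fix w assume w: "w \<in> Poly_Mapping.keys p"
    then have "set (map f w) \<subseteq> carrier A"
      using assms(2,3) by (auto simp: free_alg_carrier)
    then show "\<chi> (Poly_Mapping.lookup p w \<odot>\<^bsub>A\<^esub> list_prod A (map f w))
      = Poly_Mapping.lookup p w * (\<Prod>x\<leftarrow>w. \<chi> (f x))"
      using character_list_prod[OF rat_algebra_monoid[OF assms(1)] assms(4)]
        free_lift_terms_closed[OF assms(1-3) w]
      by (simp add: algebra_homD(5)[OF assms(4)] comp_def)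
  qed
  finally show ?thesis .
qed

lemma character_free_lift_hom:
  assumes "rat_algebra A" "\<And>x. x \<in> X \<Longrightarrow> f x \<in> carrier A" "\<chi> \<in> algebra_hom A rat_alg"
  shows "(\<lambda>p. \<chi> (free_lift A f p)) \<in> algebra_hom (free_alg X) rat_alg"
proof -
  interpret F: rat_algebra "free_alg X" by (rule rat_algebra_free_alg)
  have "linear_ext (\<lambda>w. \<Prod>x\<leftarrow>w. \<chi> (f x)) \<in> algebra_hom (free_alg X) rat_alg"
    unfolding free_alg_def by (rule linear_ext_character) (auto simp: free_monoid_def)
  note hom = algebra_homD[OF this]
  show ?thesis
    by (rule algebra_homI) (simp_all add: character_free_lift[OF assms(1,2) _ assms(3)] hom)
qed


section \<open>Characters of the algebra of pseudo-roots\<close>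

lemma pr_index_iff: "(A, i) \<in> pr_index n \<longleftrightarrow> A \<subseteq> {1..n} \<and> i \<in> {1..n} - A"
proof -
  have "card A \<le> n - 1" if "A \<subseteq> {1..n}" "i \<in> {1..n} - A"
    using card_mono[of "{1..n} - {i}" A] that by auto
  then show ?thesis by (auto simp: pr_index_def)
qed

text \<open>
  Each relation equates two sums, or two products, of two generators. This shape alone makes
  every relation hold once all generators are set to 1.
\<close>

lemma pr_relations_cases:
  assumes "r \<in> pr_relations n"
  obtains (add) a b c d where "{a, b, c, d} \<subseteq> pr_index n"
      "r = (free_gen a \<oplus>\<^bsub>free_alg (pr_index n)\<^esub> free_gen b) \<ominus>\<^bsub>free_alg (pr_index n)\<^esub>
           (free_gen c \<oplus>\<^bsub>free_alg (pr_index n)\<^esub> free_gen d)"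
    | (mult) a b c d where "{a, b, c, d} \<subseteq> pr_index n"
      "r = (free_gen a \<otimes>\<^bsub>free_alg (pr_index n)\<^esub> free_gen b) \<ominus>\<^bsub>free_alg (pr_index n)\<^esub>
           (free_gen c \<otimes>\<^bsub>free_alg (pr_index n)\<^esub> free_gen d)"
proof -
  have index: "{(A \<union> {i}, j), (A, i), (A \<union> {j}, i), (A, j)} \<subseteq> pr_index n"
    if "A \<subseteq> {1..n}" "i \<in> {1..n} - A" "j \<in> {1..n} - A" "i \<noteq> j" for A i j
    using that by (auto simp: pr_index_iff)
  show ?thesis
    using assms unfolding pr_relations_def Let_def
    by (elim UnE CollectE exE conjE) (use index that in metis)+
qed

lemma pr_relations_carrier: "pr_relations n \<subseteq> carrier (free_alg (pr_index n))"
proof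
  interpret F: rat_algebra "free_alg (pr_index n)" by (rule rat_algebra_free_alg)
  fix r assume "r \<in> pr_relations n"
  then show "r \<in> carrier (free_alg (pr_index n))"
    by (cases rule: pr_relations_cases) (auto intro!: F.minus_closed free_gen_closed)
qed

lemma ideal_pr_ideal: "ideal (pr_ideal n) (free_alg (pr_index n))"
proof -
  interpret F: rat_algebra "free_alg (pr_index n)" by (rule rat_algebra_free_alg)
  show ?thesis
    unfolding pr_ideal_def by (intro F.genideal_ideal pr_relations_carrier)
qed

lemma rat_algebra_pr_alg: "rat_algebra (pr_alg n)"
  unfolding pr_alg_def by (intro rat_algebra_quot_alg rat_algebra_free_alg ideal_pr_ideal)

text \<open>
  The character that sends every generator to 1, induced by the augmentation of the free algebra.
\<close>

definition pr_one_char :: "((nat set \<times> nat) list \<Rightarrow>\<^sub>0 rat) set \<Rightarrow> rat" where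
  "pr_one_char = quot_char (linear_ext (\<lambda>w. 1))"

lemma
  shows pr_one_char_hom: "pr_one_char \<in> algebra_hom (pr_alg n) rat_alg"
    and pr_one_char_gen: "(A, i) \<in> pr_index n \<Longrightarrow> pr_one_char (pr_gen n A i) = 1"
proof -
  let ?F = "free_alg (pr_index n)" and ?aug = "linear_ext (\<lambda>w. 1)"
  interpret F: rat_algebra ?F by (rule rat_algebra_free_alg)
  have aug: "?aug \<in> algebra_hom ?F rat_alg"
    unfolding free_alg_def by (rule linear_ext_character) auto
  have gen: "?aug (free_gen x) = 1" for x :: "nat set \<times> nat"
    by (simp add: free_gen_def)
  have "?aug r = 0" if "r \<in> pr_relations n" for r
    using that
    by (cases rule: pr_relations_cases)
      (simp_all add: character_minus[OF F.M.abelian_group_axioms aug] algebra_homD(2,3)[OF aug]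
        free_gen_closed gen)
  with pr_relations_carrier have "pr_ideal n \<subseteq> {p \<in> carrier ?F. ?aug p = 0}"
    unfolding pr_ideal_def
    by (intro F.genideal_minimal ideal_character_kernel F.rat_algebra_axioms aug) auto
  then have vanish: "\<And>p. p \<in> pr_ideal n \<Longrightarrow> ?aug p = 0" by blast
  show "pr_one_char \<in> algebra_hom (pr_alg n) rat_alg"
    unfolding pr_one_char_def pr_alg_def
    by (intro quot_char_hom F.rat_algebra_axioms ideal_pr_ideal aug vanish)
  show "pr_one_char (pr_gen n A i) = 1" if "(A, i) \<in> pr_index n"
    unfolding pr_one_char_def pr_gen_def
    using quot_char_coset[OF ideal_pr_ideal aug vanish free_gen_closed[OF that]]
    by (simp add: gen)
qed

lemma pr_y_index: "r \<in> {1..n} \<Longrightarrow> ({1..<r}, r) \<in> pr_index n"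
  by (auto simp: pr_index_iff)

lemma pr_y_closed:
  assumes "r \<in> {1..n}"
  shows "pr_y n r \<in> carrier (pr_alg n)"
proof -
  interpret F: rat_algebra "free_alg (pr_index n)" by (rule rat_algebra_free_alg)
  interpret ideal "pr_ideal n" "free_alg (pr_index n)" by (rule ideal_pr_ideal)
  show ?thesis
    unfolding pr_y_def pr_gen_def pr_alg_def quot_alg_simps
    by (intro F.a_rcosetsI[OF a_subset] free_gen_closed pr_y_index assms)
qed

lemma pr_e_terms_closed:
  assumes "S \<subseteq> {1..n}"
  shows "list_prod (pr_alg n) (map (pr_y n) (rev (sorted_list_of_set S))) \<in> carrier (pr_alg n)"
proof (rule list_prod_closed)
  have "finite S" using assms finite_subset by blast
  then show "set (map (pr_y n) (rev (sorted_list_of_set S))) \<subseteq> carrier (pr_alg n)"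
    using assms pr_y_closed by auto
qed (rule rat_algebra_monoid[OF rat_algebra_pr_alg])

lemma pr_e_closed: "pr_e n r \<in> carrier (pr_alg n)"
proof -
  interpret rat_algebra "pr_alg n" by (rule rat_algebra_pr_alg)
  show ?thesis
    unfolding pr_e_def by (intro M.finsum_closed) (auto intro: pr_e_terms_closed simp del: One_nat_def)
qed

text \<open>
  The values of a character commute, so the decreasing order of the factors in \<open>e\<^sub>r\<close> disappears and
  an ordinary elementary symmetric polynomial remains.
\<close>

lemma character_pr_e:
  assumes "\<phi> \<in> algebra_hom (pr_alg n) rat_alg"
  shows "\<phi> (pr_e n r) = (\<Sum>S | S \<subseteq> {1..n} \<and> card S = r. \<Prod>i\<in>S. \<phi> (pr_y n i))"
proof -
  interpret rat_algebra "pr_alg n" by (rule rat_algebra_pr_alg)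
  have "\<phi> (pr_e n r) = (\<Sum>S | S \<subseteq> {1..n} \<and> card S = r.
      \<phi> (list_prod (pr_alg n) (map (pr_y n) (rev (sorted_list_of_set S)))))"
    unfolding pr_e_def
    by (intro character_finsum M.abelian_monoid_axioms assms) (auto intro: pr_e_terms_closed simp del: One_nat_def)
  also have "\<dots> = (\<Sum>S | S \<subseteq> {1..n} \<and> card S = r. \<Prod>i\<in>S. \<phi> (pr_y n i))"
  proof (intro sum.cong refl)
    fix S assume "S \<in> {S. S \<subseteq> {1..n} \<and> card S = r}"
    then have S: "S \<subseteq> {1..n}" "finite S" using finite_subset by auto
    let ?ys = "map (pr_y n) (rev (sorted_list_of_set S))"
    have "\<phi> (list_prod (pr_alg n) ?ys) = prod_list (map \<phi> ?ys)"
      using S pr_y_closed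
      by (intro character_list_prod rat_algebra_monoid rat_algebra_pr_alg assms) auto
    also have "\<dots> = (\<Prod>i\<in>set (rev (sorted_list_of_set S)). \<phi> (pr_y n i))"
      by (subst prod.distinct_set_conv_list) (simp_all add: comp_def)
    finally show "\<phi> (list_prod (pr_alg n) ?ys) = (\<Prod>i\<in>S. \<phi> (pr_y n i))"
      using S by simp
  qed
  finally show ?thesis .
qed

text \<open>
  The elementary symmetric polynomial at \<open>(1, \<dots>, 1)\<close> counts the r-subsets of an n-set.
\<close>

lemma pr_one_char_e: "pr_one_char (pr_e n r) = of_nat (n choose r)"
proof -
  have "pr_one_char (pr_e n r)
    = (\<Sum>S | S \<subseteq> {1..n} \<and> card S = r. \<Prod>i\<in>S. pr_one_char (pr_y n i))"
    by (rule character_pr_e[OF pr_one_char_hom])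
  also have "\<dots> = (\<Sum>S | S \<subseteq> {1..n} \<and> card S = r. 1)"
    by (intro sum.cong refl prod.neutral ballI)
      (auto simp: pr_y_def simp del: One_nat_def intro!: pr_one_char_gen pr_y_index)
  also have "\<dots> = of_nat (n choose r)"
    using n_subsets[of "{1..n}" r] by simp
  finally show ?thesis .
qed


section \<open>Noncommutative symmetric functions\<close>

lemma rat_algebra_nsym: "rat_algebra (nsym n)"
  unfolding nsym_def by (rule rat_algebra_free_alg)

lemma nsym_z_closed: "r \<le> n \<Longrightarrow> nsym_z r \<in> carrier (nsym n)"
  by (auto simp: nsym_z_def nsym_def free_gen_closed) (simp add: free_alg_carrier)

lemma nsym_comult_terms_closed:
  assumes "r \<in> {1..n}"
  shows "(\<Oplus>\<^bsub>tensor_alg (nsym n) (nsym n)\<^esub>i\<in>{0..r}.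
    tensor (nsym n) (nsym n) (nsym_z i) (nsym_z (r - i))) \<in> carrier (tensor_alg (nsym n) (nsym n))"
proof -
  interpret T: rat_algebra "tensor_alg (nsym n) (nsym n)"
    by (intro rat_algebra_tensor_alg rat_algebra_nsym)
  show ?thesis
    using assms by (intro T.M.finsum_closed) (auto intro!: tensor_closed rat_algebra_nsym nsym_z_closed)
qed

lemma nsym_comult_closed:
  assumes "z \<in> carrier (nsym n)"
  shows "nsym_comult n z \<in> carrier (tensor_alg (nsym n) (nsym n))"
  unfolding nsym_comult_def using assms
  by (intro free_lift_closed[where X = "{1..n}"] rat_algebra_tensor_alg rat_algebra_nsym
      nsym_comult_terms_closed) (simp_all add: nsym_def)

lemma tensor_char_nsym_comult:
  assumes "\<alpha> \<in> algebra_hom (nsym n) rat_alg" "\<beta> \<in> algebra_hom (nsym n) rat_alg"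
    and "r \<in> {1..n}"
  shows "tensor_char \<alpha> \<beta> (nsym_comult n (nsym_z r))
    = (\<Sum>i\<le>r. \<alpha> (nsym_z i) * \<beta> (nsym_z (r - i)))"
proof -
  let ?T = "tensor_alg (nsym n) (nsym n)"
  interpret T: rat_algebra ?T by (intro rat_algebra_tensor_alg rat_algebra_nsym)
  note hom = tensor_char_hom[OF rat_algebra_nsym rat_algebra_nsym assms(1,2)]
  have "tensor_char \<alpha> \<beta> (nsym_comult n (nsym_z r)) = tensor_char \<alpha> \<beta>
      (\<Oplus>\<^bsub>?T\<^esub>i\<in>{0..r}. tensor (nsym n) (nsym n) (nsym_z i) (nsym_z (r - i)))"
    unfolding nsym_comult_def using assms(3) nsym_z_closed[of r n]
    by (subst character_free_lift[OF T.rat_algebra_axioms nsym_comult_terms_closed _ hom])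
      (auto simp: nsym_def nsym_z_def free_gen_def)
  also have "\<dots> = (\<Sum>i\<in>{0..r}. tensor_char \<alpha> \<beta> (tensor (nsym n) (nsym n) (nsym_z i) (nsym_z (r - i))))"
    using assms(3)
    by (intro character_finsum T.M.abelian_monoid_axioms hom)
      (auto intro!: tensor_closed rat_algebra_nsym nsym_z_closed)
  also have "\<dots> = (\<Sum>i\<le>r. \<alpha> (nsym_z i) * \<beta> (nsym_z (r - i)))"
    using assms(3)
    by (intro sum.cong tensor_char_tensor rat_algebra_nsym assms(1,2) nsym_z_closed) auto
  finally show ?thesis .
qed

lemma nsym_embedding_closed:
  assumes "z \<in> carrier (nsym n)"
  shows "nsym_embedding n z \<in> carrier (pr_alg n)"
  unfolding nsym_embedding_def using assms
  by (intro free_lift_closed[where X = "{1..n}"] rat_algebra_pr_alg pr_e_closed) (simp add: nsym_def)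

lemma character_nsym_embedding_hom:
  assumes "\<chi> \<in> algebra_hom (pr_alg n) rat_alg"
  shows "(\<lambda>z. \<chi> (nsym_embedding n z)) \<in> algebra_hom (nsym n) rat_alg"
  unfolding nsym_embedding_def nsym_def
  by (intro character_free_lift_hom rat_algebra_pr_alg pr_e_closed assms)

lemma character_nsym_embedding_z:
  assumes "\<chi> \<in> algebra_hom (pr_alg n) rat_alg" "r \<le> n"
  shows "\<chi> (nsym_embedding n (nsym_z r)) = (if r = 0 then 1 else \<chi> (pr_e n r))"
  unfolding nsym_embedding_def using nsym_z_closed[OF assms(2)]
  by (subst character_free_lift[where X = "{1..n}"])
    (auto simp: rat_algebra_pr_alg pr_e_closed assms(1) nsym_def nsym_z_def free_gen_def)


section \<open>Power sums and elementary symmetric polynomials\<close>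

lemma sum_subsets_card_1:
  fixes c :: "'i \<Rightarrow> 'a :: comm_semiring_1"
  shows "(\<Sum>S | S \<subseteq> F \<and> card S = 1. \<Prod>i\<in>S. c i) = (\<Sum>i\<in>F. c i)"
proof -
  have "{S. S \<subseteq> F \<and> card S = 1} = (\<lambda>i. {i}) ` F"
    by (auto simp: card_1_singleton_iff)
  then show ?thesis by (simp add: sum.reindex)
qed

text \<open>
  Newton's identity \<open>e\<^sub>1\<^sup>2 = p\<^sub>2 + 2 e\<^sub>2\<close>. In the induction step, the 2-subsets that contain the new element
  x correspond to the 1-subsets of the old set.
\<close>

lemma square_of_sum_eq:
  fixes c :: "'i \<Rightarrow> 'a :: comm_ring_1"
  assumes "finite F"
  shows "(\<Sum>i\<in>F. c i)\<^sup>2 = (\<Sum>i\<in>F. (c i)\<^sup>2) + 2 * (\<Sum>S | S \<subseteq> F \<and> card S = 2. \<Prod>i\<in>S. c i)"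
  using assms
proof (induction F rule: finite_induct)
  case empty
  have "{S. S \<subseteq> {} \<and> card S = 2} = ({} :: 'i set set)" by auto
  then show ?case by (simp only:) simp
next
  case (insert x F)
  let ?P = "\<lambda>k. {S. S \<subseteq> F \<and> card S = k}"
  have "{S. S \<subseteq> insert x F \<and> card S = 2} = ?P 2 \<union> insert x ` ?P 1"
  proof (intro equalityI subsetI)
    fix S assume "S \<in> {S. S \<subseteq> insert x F \<and> card S = 2}"
    then have S: "S \<subseteq> insert x F" "card S = 2" by auto
    show "S \<in> ?P 2 \<union> insert x ` ?P 1"
    proof (cases "x \<in> S")
      case True
      then have "S = insert x (S - {x})" "S - {x} \<in> ?P 1" using S by auto
      then show ?thesis by blast
    qed (use S in auto)
  qed (use insert finite_subset in \<open>fastforce simp: card_insert_if\<close>)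
  moreover have "?P 2 \<inter> insert x ` ?P 1 = {}" using insert by auto
  moreover have "inj_on (insert x) (?P 1)"
    using insert by (auto simp: inj_on_def insert_ident subset_iff)
  ultimately have "(\<Sum>S | S \<subseteq> insert x F \<and> card S = 2. \<Prod>i\<in>S. c i)
    = (\<Sum>S\<in>?P 2. \<Prod>i\<in>S. c i) + (\<Sum>S\<in>?P 1. \<Prod>i\<in>insert x S. c i)"
    using insert by (simp add: sum.union_disjoint sum.reindex)
  also have "(\<Sum>S\<in>?P 1. \<Prod>i\<in>insert x S. c i) = (\<Sum>S\<in>?P 1. c x * (\<Prod>i\<in>S. c i))"
    using insert finite_subset[of _ F] by (intro sum.cong refl prod.insert) auto
  also have "\<dots> = c x * (\<Sum>i\<in>F. c i)"
    by (simp add: sum_distrib_left[symmetric] sum_subsets_card_1[where F = F and c = c, simplified])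
  finally show ?case
    using insert by (simp add: power2_sum algebra_simps)
qed


section \<open>Non-extendability of the bialgebra structure\<close>

theorem theorem7:
  fixes n :: nat
  assumes "n \<ge> 2"
  shows "\<not> (\<exists>\<Delta> \<epsilon>. rat_bialgebra (pr_alg n) \<Delta> \<epsilon> \<and>
      (\<forall>z\<in>carrier (nsym n).
         \<Delta> (nsym_embedding n z) =
         tensor_map (pr_alg n) (pr_alg n) (nsym_embedding n) (nsym_embedding n) (nsym_comult n z)) \<and>
      (\<forall>z\<in>carrier (nsym n). \<epsilon> (nsym_embedding n z) = nsym_counit z))"
proof (intro notI, elim exE conjE)
  fix \<Delta> \<epsilon>
  assume "rat_bialgebra (pr_alg n) \<Delta> \<epsilon>"
    and extends: "\<forall>z\<in>carrier (nsym n). \<Delta> (nsym_embedding n z) =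
      tensor_map (pr_alg n) (pr_alg n) (nsym_embedding n) (nsym_embedding n) (nsym_comult n z)"
  then interpret rat_bialgebra "pr_alg n" \<Delta> \<epsilon> by simp
  note pr = rat_algebra_pr_alg[of n]
  \<comment> \<open>the convolution square of \<^const>\<open>pr_one_char\<close>\<close>
  define \<phi> where "\<phi> = (\<lambda>x. tensor_char pr_one_char pr_one_char (\<Delta> x))"
  have \<phi>: "\<phi> \<in> algebra_hom (pr_alg n) rat_alg"
    unfolding \<phi>_def
    by (rule algebra_hom_compose[OF comult_hom])
      (intro tensor_char_hom pr pr_one_char_hom)
  have \<phi>_e: "\<phi> (pr_e n r) = of_nat (2 * n choose r)" if r: "r \<in> {1..n}" for r
  proof -
    let ?\<alpha> = "\<lambda>z. pr_one_char (nsym_embedding n z)"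
    have \<alpha>: "?\<alpha> \<in> algebra_hom (nsym n) rat_alg"
      by (rule character_nsym_embedding_hom[OF pr_one_char_hom])
    have \<alpha>_z: "?\<alpha> (nsym_z i) = of_nat (n choose i)" if "i \<le> n" for i
      using that by (simp add: character_nsym_embedding_z[OF pr_one_char_hom] pr_one_char_e)
    have z: "nsym_z r \<in> carrier (nsym n)" using r by (intro nsym_z_closed) auto
    have "\<phi> (pr_e n r) = \<phi> (nsym_embedding n (nsym_z r))"
      using r by (simp add: character_nsym_embedding_z[OF \<phi>])
    also have "\<dots> = tensor_char pr_one_char pr_one_char
        (tensor_map (pr_alg n) (pr_alg n) (nsym_embedding n) (nsym_embedding n) (nsym_comult n (nsym_z r)))"
      using extends z by (simp add: \<phi>_def)
    also have "\<dots> = tensor_char ?\<alpha> ?\<alpha> (nsym_comult n (nsym_z r))"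
      by (intro tensor_char_tensor_map[where C = "nsym n" and D = "nsym n"] pr rat_algebra_nsym pr_one_char_hom \<alpha>
          nsym_embedding_closed nsym_comult_closed z)
    also have "\<dots> = (\<Sum>i\<le>r. ?\<alpha> (nsym_z i) * ?\<alpha> (nsym_z (r - i)))"
      by (rule tensor_char_nsym_comult[OF \<alpha> \<alpha> r])
    also have "\<dots> = (\<Sum>i\<le>r. of_nat ((n choose i) * (n choose (r - i))))"
      using r by (intro sum.cong refl) (simp add: \<alpha>_z le_diff_conv)
    also have "\<dots> = of_nat (2 * n choose r)"
      by (simp add: vandermonde[symmetric] mult_2)
    finally show ?thesis .
  qed
  define c where "c i = \<phi> (pr_y n i)" for i
  have sum: "(\<Sum>i\<in>{1..n}. c i) = 2 * of_nat n"
    using \<phi>_e[of 1] assms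
    by (simp add: character_pr_e[OF \<phi>] c_def sum_subsets_card_1[simplified])
  have "(\<Sum>S | S \<subseteq> {1..n} \<and> card S = 2. \<Prod>i\<in>S. c i) = of_nat (2 * n choose 2)"
    using \<phi>_e[of 2] assms by (simp add: character_pr_e[OF \<phi>] c_def)
  also have "2 * n choose 2 = n * (2 * n - 1)"
    by (simp add: choose_two)
  finally have "(\<Sum>i\<in>{1..n}. (c i)\<^sup>2) = (2 * of_nat n)\<^sup>2 - 2 * of_nat (n * (2 * n - 1))"
    using square_of_sum_eq[of "{1..n}" c] sum by simp
  also have "\<dots> = 2 * of_nat n"
    using assms by (simp add: of_nat_diff power2_eq_square algebra_simps)
  finally have squares: "(\<Sum>i\<in>{1..n}. (c i)\<^sup>2) = 2 * of_nat n" .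
  \<comment> \<open>The number 2 is the mean of the \<open>c\<^sub>i\<close>, so their variance would be negative.\<close>
  have "(\<Sum>i\<in>{1..n}. (c i - 2)\<^sup>2)
    = (\<Sum>i\<in>{1..n}. (c i)\<^sup>2) - 4 * (\<Sum>i\<in>{1..n}. c i) + 4 * of_nat n"
    by (simp add: power2_diff sum.distrib sum_subtractf sum_distrib_left algebra_simps)
  also have "\<dots> = - 2 * of_nat n"
    unfolding sum squares by simp
  also have "\<dots> < 0"
    using assms by simp
  finally show False
    using sum_nonneg[of "{1..n}" "\<lambda>i. (c i - 2)\<^sup>2"] by simp
qed

end
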